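(* Let $M,K,r\colon\mathbb{R}_+\to(0,\infty)$ be non-decreasing functions and assume that $M$ and $K$ are continuous. Let $M_K\colon\mathbb{R}_+\to(0,\infty)$ be defined by $M_K(s)=M(s)\big(\log(1+s)+\log(1+K(s))\big)$, $s\ge0$, and suppose that $M_K(s)=O(e^{\alpha s})$ as $s\to\infty$ for some $\alpha>0$. Suppose that $$|f(t)|=O\big(r(t)^{-1}\big),\quad t\to\infty,$$ for every bounded Lipschitz continuous function $f\colon\mathbb{R}_+\to\mathbb{C}$ such that $f'$ is uniformly continuous and the Laplace transform $\widehat{f}$ of $f$ extends analytically to the region $\Omega_M$ and satisfies $$\sup_{\lambda\in\Omega_M}\frac{|\lambda\widehat{f}(\lambda)|}{K(|\operatorname{Im}\lambda|)}<\infty.$$ Then $$r(t)=O\big(M_K^{-1}(t)\big),\quad t\to\infty.$$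
   Context: Here $\mathbb{R}_+=[0,\infty)$. For a continuous non-decreasing function $M\colon\mathbb{R}_+\to(0,\infty)$, $$\Omega_M=\left\{\lambda\in\mathbb{C}:\operatorname{Re}\lambda>-\frac{1}{M(|\operatorname{Im}\lambda|)}\right\}.$$ The Laplace transform of a bounded measurable $f\colon\mathbb{R}_+\to\mathbb{C}$ is $\widehat{f}(\lambda)=\int_0^\infty e^{-\lambda t}f(t)\,\mathrm{d}t$ for $\operatorname{Re}\lambda>0$, and the same symbol denotes its analytic extension. The function $M_K$ is continuous, strictly increasing and unbounded, and $M_K^{-1}$ denotes its inverse, defined on $[M_K(0),\infty)$ and hence for all sufficiently large $t$. The implicit constant in $|f(t)|=O(r(t)^{-1})$ is allowed to depend on $f$. *)

theory Defs
  imports "HOL-Analysis.Analysis" "HOL-Library.Landau_Symbols"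
begin

text \<open>
  Functions on \<open>[0,\<infinity>)\<close> are represented by total functions on \<open>real\<close>;
  all conditions are imposed on \<open>{0..}\<close> only, and values at negative arguments are irrelevant.
\<close>

definition Omega :: "(real \<Rightarrow> real) \<Rightarrow> complex set" where
  "Omega M = {z. Re z > - 1 / M \<bar>Im z\<bar>}"

definition M_K :: "(real \<Rightarrow> real) \<Rightarrow> (real \<Rightarrow> real) \<Rightarrow> real \<Rightarrow> real" where
  "M_K M K s = M s * (ln (1 + s) + ln (1 + K s))"

text \<open>
  Under the assumptions made on \<open>M\<close> and \<open>K\<close>, \<open>M_K M K\<close> is a bijection
  from \<open>{0..}\<close> onto \<open>{M_K M K 0..}\<close>, so the inverse
  is meaningful for all sufficiently large arguments.
\<close>

definition M_K_inv :: "(real \<Rightarrow> real) \<Rightarrow> (real \<Rightarrow> real) \<Rightarrow> real \<Rightarrow> real" where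
  "M_K_inv M K = inv_into {0..} (M_K M K)"

definition laplace_transform :: "(real \<Rightarrow> complex) \<Rightarrow> complex \<Rightarrow> complex" where
  "laplace_transform f z = (LBINT t:{0..}. exp (- z * complex_of_real t) * f t)"

text \<open>
  The derivative at \<open>0\<close> is one-sided. The extension \<open>F\<close> is unique on \<open>Omega M\<close>,
  which is open, connected and contains the right half-plane when \<open>M\<close> is positive
  and continuous on \<open>{0..}\<close>.
\<close>

definition admissible :: "(real \<Rightarrow> real) \<Rightarrow> (real \<Rightarrow> real) \<Rightarrow> (real \<Rightarrow> complex) \<Rightarrow> bool" where
  "admissible M K f \<longleftrightarrow>
     bounded (f ` {0..}) \<and>
     (\<exists>L. L-lipschitz_on {0..} f) \<and>
     (\<exists>f'. (\<forall>t\<ge>0. (f has_vector_derivative f' t) (at t within {0..})) \<and>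
           uniformly_continuous_on {0..} f') \<and>
     (\<exists>F. F analytic_on Omega M \<and>
          (\<forall>z. Re z > 0 \<longrightarrow> F z = laplace_transform f z) \<and>
          bdd_above ((\<lambda>z. norm (z * F z) / K \<bar>Im z\<bar>) ` Omega M))"

end

theory Submission
  imports Defs "HOL-Complex_Analysis.Complex_Analysis" "HOL-Real_Asymp.Real_Asymp"
    "HOL-Probability.Sinc_Integral" "HOL-Probability.Characteristic_Functions"
begin

text \<open>
  For large \<open>s\<close> put \<open>y = M_K s\<close> and let \<open>f_s t\<close> be the Fourier integral along the imaginary axis of
  \<open>G_s z = \<psi>_s z * exp (- y z)\<close>, where \<open>\<psi>_s\<close> lives at heights \<open>Im z\<close> of order \<open>s\<close>. Then
  \<open>\<bar>f_s\<bar>\<close> is at most of order \<open>1 / s\<close>, and this order is attained at \<open>t = y\<close>. Up to a bounded term,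
  the continuation of \<open>\<lambda>\<close> times the Laplace transform of \<open>f_s\<close> to the left of the imaginary axis is
  \<open>2 \<pi> \<lambda> G_s \<lambda>\<close>; on \<open>Omega M\<close> at height \<open>w \<ge> s\<close> the exponential \<open>exp (- y \<lambda>)\<close> costs at most
  \<open>exp (M_K s / M w) \<le> (1 + s) (1 + K w)\<close>, and \<open>\<psi>_s\<close> absorbs the factor \<open>1 + s\<close>. At heights below
  \<open>s\<close> the cost \<open>exp (A y)\<close> is doubly exponential in \<open>s\<close>, and there \<open>\<psi>_s\<close> is even smaller.

  If \<open>r\<close> were not \<open>O(M_K_inv)\<close>, then \<open>r (M_K s) / s\<close> would be unbounded, and a gliding hump series
  of multiples of functions \<open>f_s\<close> would be an admissible function violating the hypothesis.
\<close>

section \<open>Cauchy transforms of integrable functions on vertical lines\<close>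

lemma integral_norm_bound_nonneg:
  fixes f :: "'a \<Rightarrow> 'b::{banach, second_countable_topology}"
  assumes h: "integrable M h" and f: "f \<in> borel_measurable M" and le: "\<And>x. norm (f x) \<le> h x"
  shows "norm (\<integral>x. f x \<partial>M) \<le> (\<integral>x. h x \<partial>M)"
proof -
  have "integrable M f"
    using le by (intro Bochner_Integration.integrable_bound[OF h f] AE_I2)
      (metis abs_of_nonneg norm_ge_zero order_trans real_norm_def)
  then have "(\<integral>x. norm (f x) \<partial>M) \<le> (\<integral>x. h x \<partial>M)"
    using h le by (intro integral_mono) auto
  then show ?thesis
    by (rule order_trans[OF integral_norm_bound])
qed

lemma norm_diff_Complex_ge: "\<bar>Re l - c\<bar> \<le> norm (l - Complex c w)"
  using abs_Re_le_cmod[of "l - Complex c w"] by simp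

lemma borel_measurable_Complex_line [measurable]: "Complex c \<in> borel_measurable borel"
proof -
  have "Complex c = (\<lambda>w. of_real c + \<i> * of_real w)"
    by (auto simp: complex_eq_iff)
  then show ?thesis by simp
qed

lemma integrable_cauchy_kernel:
  fixes g :: "real \<Rightarrow> complex"
  assumes g: "integrable lborel g" and l: "Re l \<noteq> c"
  shows "integrable lborel (\<lambda>w. g w / (l - Complex c w))"
proof (rule Bochner_Integration.integrable_bound)
  show "integrable lborel (\<lambda>w. norm (g w) / \<bar>Re l - c\<bar>)"
    using g by simp
  have [measurable]: "g \<in> borel_measurable borel"
    using g by auto
  show "(\<lambda>w. g w / (l - Complex c w)) \<in> borel_measurable lborel"
    by measurable
  show "AE w in lborel. norm (g w / (l - Complex c w)) \<le> norm (norm (g w) / \<bar>Re l - c\<bar>)"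
  proof (intro AE_I2)
    fix w
    have "norm (g w) / norm (l - Complex c w) \<le> norm (g w) / \<bar>Re l - c\<bar>"
      using norm_diff_Complex_ge[of l c w] l by (intro divide_left_mono mult_pos_pos) auto
    then show "norm (g w / (l - Complex c w)) \<le> norm (norm (g w) / \<bar>Re l - c\<bar>)"
      by (simp add: norm_divide)
  qed
qed

text \<open>With \<open>p = l - Complex c w\<close>, the difference quotient of \<open>1 / p\<close>
  differs from its derivative by exactly \<open>h / (p^2 * (p + h))\<close>. Both \<open>p\<close>
  and \<open>p + h\<close> stay away from \<open>0\<close> uniformly in \<open>w\<close>, so the
  integrated error is at most \<open>norm h\<close> times a constant.\<close>

lemma holomorphic_on_cauchy_transform:
  fixes g :: "real \<Rightarrow> complex"
  assumes g: "integrable lborel g"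
  shows "(\<lambda>l. \<integral>w. g w / (l - Complex c w) \<partial>lborel) holomorphic_on {l. Re l \<noteq> c}"
proof -
  define F where "F l = (\<integral>w. g w / (l - Complex c w) \<partial>lborel)" for l
  have "\<exists>D. (F has_field_derivative D) (at l)" if l: "Re l \<noteq> c" for l
  proof -
    \<comment> \<open>Half the distance from \<open>l\<close> to the line, so that
      \<open>l + h\<close> with \<open>norm h < \<delta>\<close> also keeps distance
      \<open>\<delta>\<close> from it.\<close>
    define \<delta> where "\<delta> = \<bar>Re l - c\<bar> / 2"
    have \<delta>: "\<delta> > 0" using l by (simp add: \<delta>_def)
    have [measurable]: "g \<in> borel_measurable borel"
      using g by auto
    define D where "D = - (\<integral>w. g w / (l - Complex c w)^2 \<partial>lborel)"
    have low0: "\<delta> \<le> norm (l - Complex c w)" for w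
      using norm_diff_Complex_ge[of l c w] \<delta> by (simp add: \<delta>_def)
    have intD: "integrable lborel (\<lambda>w. g w / (l - Complex c w)^2)"
    proof (rule Bochner_Integration.integrable_bound)
      show "integrable lborel (\<lambda>w. norm (g w) / \<delta>^2)"
        using g by simp
      show "AE w in lborel. norm (g w / (l - Complex c w)^2) \<le> norm (norm (g w) / \<delta>^2)"
        using low0 \<delta> by (auto simp: norm_divide norm_power intro!: frac_le power_mono)
    qed measurable
    have est: "norm ((F (l + h) - F l) / h - D) \<le> norm h * ((\<integral>w. norm (g w) \<partial>lborel) / \<delta>^3)"
      if h: "h \<noteq> 0" "norm h < \<delta>" for h
    proof -
      have re: "\<delta> < \<bar>Re (l + h) - c\<bar>"
        using abs_Re_le_cmod[of h] h(2) unfolding \<delta>_def by (simp add: abs_if split: if_splits)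
      have low1: "\<delta> \<le> norm (l + h - Complex c w)" for w
        using norm_diff_Complex_ge[of "l+h" c w] re by linarith
      have nz: "l + h - Complex c w \<noteq> 0" "l - Complex c w \<noteq> 0" for w
        using low1[of w] low0[of w] \<delta> by auto
      have i1: "integrable lborel (\<lambda>w. g w / (l + h - Complex c w))"
        using re \<delta> by (intro integrable_cauchy_kernel g) auto
      have i0: "integrable lborel (\<lambda>w. g w / (l - Complex c w))"
        by (intro integrable_cauchy_kernel g l)
      have "(F (l + h) - F l) / h - D =
         (\<integral>w. (g w / (l + h - Complex c w) - g w / (l - Complex c w)) / h
              + g w / (l - Complex c w)^2 \<partial>lborel)"
        unfolding F_def D_def using i1 i0 intD by simp
      also have "\<dots> = (\<integral>w. h * (g w / ((l - Complex c w)^2 * (l + h - Complex c w))) \<partial>lborel)"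
      proof (rule Bochner_Integration.integral_cong[OF refl])
        fix w
        define p where "p = l - Complex c w"
        have "(g w / (p + h) - g w / p) / h + g w / p^2 = h * (g w / (p^2 * (p + h)))"
          using nz[of w] h(1) unfolding p_def[symmetric]
          by (simp add: p_def divide_simps) (simp add: algebra_simps power2_eq_square)
        then show "(g w / (l + h - Complex c w) - g w / (l - Complex c w)) / h
              + g w / (l - Complex c w)^2 = h * (g w / ((l - Complex c w)^2 * (l + h - Complex c w)))"
          by (simp add: p_def algebra_simps)
      qed
      also have "norm \<dots> \<le> (\<integral>w. norm h * (norm (g w) / \<delta>^3) \<partial>lborel)"
      proof (rule integral_norm_bound_nonneg)
        have bnd: "norm (h * (g w / ((l - Complex c w)^2 * (l + h - Complex c w)))) \<le> norm h * (norm (g w) / \<delta>^3)" for w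
        proof -
          have "\<delta>^3 \<le> norm (l - Complex c w)^2 * norm (l + h - Complex c w)"
            unfolding power3_eq_cube power2_eq_square
            using low0[of w] low1[of w] \<delta> by (intro mult_mono) auto
          then show ?thesis
            using \<delta> by (auto simp: norm_mult norm_divide norm_power intro!: mult_left_mono frac_le)
        qed
        show "integrable lborel (\<lambda>w. norm h * (norm (g w) / \<delta>^3))"
          using g by simp
        show "(\<lambda>w. h * (g w / ((l - Complex c w)^2 * (l + h - Complex c w)))) \<in> borel_measurable lborel"
          by measurable
        show "norm (h * (g w / ((l - Complex c w)^2 * (l + h - Complex c w)))) \<le> norm h * (norm (g w) / \<delta>^3)" for w
          by (rule bnd)
      qed
      also have "\<dots> = norm h * ((\<integral>w. norm (g w) \<partial>lborel) / \<delta>^3)"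
        by simp
      finally show ?thesis .
    qed
    have "((\<lambda>h. (F (l + h) - F l) / h - D) \<longlongrightarrow> 0) (at 0)"
    proof (rule Lim_null_comparison)
      show "eventually (\<lambda>h. norm ((F (l + h) - F l) / h - D) \<le> norm h * ((\<integral>w. norm (g w) \<partial>lborel) / \<delta>^3)) (at 0)"
        unfolding eventually_at using est \<delta> by (intro exI[of _ \<delta>]) auto
      show "((\<lambda>h::complex. norm h * ((\<integral>w. norm (g w) \<partial>lborel) / \<delta>^3)) \<longlongrightarrow> 0) (at 0)"
        by (intro tendsto_mult_left_zero tendsto_norm_zero) simp
    qed
    then have "(F has_field_derivative D) (at l)"
      unfolding DERIV_def by (simp add: LIM_zero_iff)
    then show ?thesis by blast
  qed
  then have "F holomorphic_on {l. Re l \<noteq> c}"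
    unfolding holomorphic_on_def field_differentiable_def
    by (auto intro: has_field_derivative_at_within)
  then show ?thesis unfolding F_def .
qed

section \<open>The Poisson kernel and Cauchy's formula on a strip\<close>

text \<open>Rescaling of \<open>1 / (1 + w^2)\<close>. The total mass does not depend on
  \<open>s\<close>, which later keeps majorants at different scales summable.\<close>

lemma
  fixes s :: real
  assumes "s > 0"
  shows integrable_poisson_kernel: "integrable lborel (\<lambda>w. s / (s^2 + w^2))"
    and integral_poisson_kernel: "(\<integral>w. s / (s^2 + w^2) \<partial>lborel) = pi"
proof -
  have 1: "integrable lborel (\<lambda>w::real. inverse (1 + w^2))"
    using integrable_inverse_1_plus_square by (simp add: set_integrable_def)
  have 2: "(\<integral>w. inverse (1 + w^2) \<partial>(lborel :: real measure)) = pi"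
    using LBINT_inverse_1_plus_square
    by (simp add: interval_lebesgue_integral_def set_lebesgue_integral_def)
  have eq: "inverse (1 + (0 + (1 / s) * w)^2) = s * (s / (s^2 + w^2))" for w
    using assms by (simp add: field_simps power2_eq_square)
  from lborel_integrable_real_affine[OF 1, of "1 / s" 0]
  show "integrable lborel (\<lambda>w. s / (s^2 + w^2))"
    unfolding eq using assms by (simp del: times_divide_eq_right)
  from lborel_integral_real_affine[of "1 / s" "\<lambda>w. inverse (1 + w^2)" 0]
  show "(\<integral>w. s / (s^2 + w^2) \<partial>lborel) = pi"
    unfolding eq 2 using assms by (simp del: times_divide_eq_right)
qed

text \<open>Connects the Lebesgue integral over a whole vertical line with the integrals over
  \<open>[-n, n]\<close> that come from the sides of rectangles.\<close>

lemma tendsto_integral_symmetric: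
  fixes f :: "real \<Rightarrow> complex"
  assumes f: "integrable lborel f"
  shows "(\<lambda>n. integral {- real n..real n} f) \<longlonglongrightarrow> (\<integral>w. f w \<partial>lborel)"
proof -
  have [measurable]: "f \<in> borel_measurable borel"
    using f by auto
  have "(\<lambda>n. \<integral>w. indicator {- real n..real n} w *\<^sub>R f w \<partial>lborel) \<longlonglongrightarrow> (\<integral>w. f w \<partial>lborel)"
  proof (rule integral_dominated_convergence)
    show "integrable lborel (\<lambda>w. norm (f w))"
      using f by simp
    show "AE w in lborel. (\<lambda>n. indicator {- real n..real n} w *\<^sub>R f w) \<longlonglongrightarrow> f w"
    proof (intro AE_I2 tendsto_eventually)
      fix w :: real
      show "\<forall>\<^sub>F n in sequentially. indicator {- real n..real n} w *\<^sub>R f w = f w"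
        using eventually_ge_at_top[of "nat \<lceil>\<bar>w\<bar>\<rceil>"]
        by eventually_elim (auto simp: indicator_def abs_le_iff nat_le_iff ceiling_le_iff)
    qed
  qed (auto simp: indicator_def)
  moreover have "(\<integral>w. indicator {- real n..real n} w *\<^sub>R f w \<partial>lborel) = integral {- real n..real n} f" for n
  proof -
    have "set_integrable lborel {- real n..real n} f"
      using integrable_mult_indicator[OF _ f, of "{- real n..real n}"] by (simp add: set_integrable_def)
    then show ?thesis
      using set_borel_integral_eq_integral(2) by (fastforce simp: set_lebesgue_integral_def)
  qed
  ultimately show ?thesis by simp
qed

text \<open>Cauchy's integral formula on rectangles that exhaust the strip: the decay
  \<open>C / (1 + (Im z)^2)\<close> makes the horizontal sides vanish in the limit, and only the two
  vertical lines and the residue at \<open>l\<close> remain.\<close>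

lemma cauchy_formula_strip:
  fixes G :: "complex \<Rightarrow> complex"
  assumes hol: "G holomorphic_on {z. p \<le> Re z \<and> Re z \<le> q}"
    and bnd: "\<And>z. p \<le> Re z \<Longrightarrow> Re z \<le> q \<Longrightarrow> norm (G z) \<le> C / (1 + (Im z)^2)"
    and l: "p < Re l" "Re l < q"
    and int: "integrable lborel (\<lambda>w. G (Complex p w))" "integrable lborel (\<lambda>w. G (Complex q w))"
  shows "(\<integral>w. G (Complex p w) / (l - Complex p w) \<partial>lborel)
    = 2 * pi * G l + (\<integral>w. G (Complex q w) / (l - Complex q w) \<partial>lborel)"
proof -
  define H where "H z = G z / (z - l)" for z
  define S where "S = {z. p \<le> Re z \<and> Re z \<le> q}"
  have S_eq: "S = {z. p \<le> Re z} \<inter> {z. Re z \<le> q}" by (auto simp: S_def)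
  have cS: "convex S"
    unfolding S_eq by (intro convex_Int convex_halfspace_Re_ge convex_halfspace_Re_le)
  have "{z. p < Re z} \<inter> {z. Re z < q} \<subseteq> interior S"
    by (intro interior_maximal open_Int open_halfspace_Re_gt open_halfspace_Re_lt) (auto simp: S_def)
  then have lS: "l \<in> interior S" using l by auto
  have C0: "C \<ge> 0"
    using bnd[of "Complex p 0"] l by (simp add: order_trans[OF norm_ge_zero])
  have pq: "p < q" using l by simp
  \<comment> \<open>From \<open>N\<close> on, the rectangle of half-height \<open>n\<close> contains
    \<open>l\<close> in its interior.\<close>
  define N where "N = nat \<lceil>\<bar>Im l\<bar>\<rceil> + 1"
  define T where "T n = contour_integral (linepath (Complex p (- real n)) (Complex q (- real n))) H" for n
  define U where "U n = contour_integral (linepath (Complex q (real n)) (Complex p (real n))) H" for n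
  have Nl: "\<bar>Im l\<bar> < real n" if "n \<ge> N" for n
    using that unfolding N_def by linarith
  have contH: "continuous_on (S - {l}) H"
    unfolding H_def using hol S_def
    by (intro continuous_intros holomorphic_on_imp_continuous_on) (auto intro: holomorphic_on_subset)
  \<comment> \<open>The four sides counterclockwise: bottom, right, top, left. The left side is run
    upwards instead, hence its minus sign.\<close>
  have eq: "T n + \<i> * integral {- real n..real n} (\<lambda>w. H (Complex q w)) + U n
      - \<i> * integral {- real n..real n} (\<lambda>w. H (Complex p w)) = 2 * pi * \<i> * G l" if n: "n \<ge> N" for n
  proof -
    define \<gamma> where "\<gamma> = rectpath (Complex p (- real n)) (Complex q (real n))"
    have n0: "real n > 0" using Nl[OF n] by linarith
    have im: "path_image \<gamma> \<subseteq> S - {l}"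
      unfolding \<gamma>_def using l Nl[OF n] n0 by (subst path_image_rectpath) (auto simp: S_def)
    have w: "winding_number \<gamma> l = 1"
      unfolding \<gamma>_def using l Nl[OF n]
      by (intro winding_number_rectpath) (auto simp: in_box_complex_iff abs_less_iff)
    have "(H has_contour_integral (2 * pi * \<i> * winding_number \<gamma> l * G l)) \<gamma>"
      unfolding H_def using hol
      by (intro Cauchy_integral_formula_convex_simple[OF cS _ lS _ im]) (auto simp: S_def \<gamma>_def)
    then have 1: "contour_integral \<gamma> H = 2 * pi * \<i> * G l"
      and ci: "H contour_integrable_on \<gamma>"
      using w by (auto dest: contour_integral_unique simp: contour_integrable_on_def)
    have lin: "\<gamma> = linepath (Complex p (- real n)) (Complex q (- real n)) +++
       linepath (Complex q (- real n)) (Complex q (real n)) +++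
       linepath (Complex q (real n)) (Complex p (real n)) +++
       linepath (Complex p (real n)) (Complex p (- real n))"
      by (simp add: \<gamma>_def rectpath_def Let_def)
    have sides: "H contour_integrable_on linepath (Complex p (- real n)) (Complex q (- real n))"
       "H contour_integrable_on linepath (Complex q (- real n)) (Complex q (real n))"
       "H contour_integrable_on linepath (Complex q (real n)) (Complex p (real n))"
       "H contour_integrable_on linepath (Complex p (real n)) (Complex p (- real n))"
      using ci unfolding lin by (auto simp: contour_integrable_join)
    have "contour_integral \<gamma> H = T n + (contour_integral (linepath (Complex q (- real n)) (Complex q (real n))) H
        + (U n + contour_integral (linepath (Complex p (real n)) (Complex p (- real n))) H))"
      unfolding lin T_def U_def using sides by (simp add: contour_integrable_join)
    also have "contour_integral (linepath (Complex p (real n)) (Complex p (- real n))) H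
       = - contour_integral (linepath (Complex p (- real n)) (Complex p (real n))) H"
      using contour_integral_reversepath[of "linepath (Complex p (- real n)) (Complex p (real n))" H] by simp
    also have "contour_integral (linepath (Complex p (- real n)) (Complex p (real n))) H =
        \<i> * integral {- real n..real n} (\<lambda>w. H (Complex p w))"
      using n0 by (intro contour_integral_linepath_same_Re) auto
    also have "contour_integral (linepath (Complex q (- real n)) (Complex q (real n))) H =
        \<i> * integral {- real n..real n} (\<lambda>w. H (Complex q w))"
      using n0 by (intro contour_integral_linepath_same_Re) auto
    finally show ?thesis using 1 by (simp add: algebra_simps)
  qed
  \<comment> \<open>Allowing either order of \<open>p\<close> and \<open>q\<close> covers the bottom
    side, run to the right, and the top side, run to the left.\<close>
  have horiz: "norm (contour_integral (linepath (Complex x1 v) (Complex x2 v)) H) 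
     \<le> C / (1 + v^2) / (\<bar>v\<bar> - \<bar>Im l\<bar>) * (q - p)" 
    if v: "\<bar>v\<bar> > \<bar>Im l\<bar>" and x: "{x1, x2} = {p, q}" for v x1 x2
  proof -
    have seg: "p \<le> Re z \<and> Re z \<le> q \<and> Im z = v" if "z \<in> closed_segment (Complex x1 v) (Complex x2 v)" for z
      using that x pq by (auto simp: closed_segment_same_Im doubleton_eq_iff closed_segment_eq_real_ivl split: if_splits)
    then have "closed_segment (Complex x1 v) (Complex x2 v) \<subseteq> S - {l}"
      using v by (auto simp: S_def)
    then have "H contour_integrable_on linepath (Complex x1 v) (Complex x2 v)"
      using contH by (intro contour_integrable_continuous_linepath) (rule continuous_on_subset)
    then have "(H has_contour_integral contour_integral (linepath (Complex x1 v) (Complex x2 v)) H) (linepath (Complex x1 v) (Complex x2 v))"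
      by (rule has_contour_integral_integral)
    then have "norm (contour_integral (linepath (Complex x1 v) (Complex x2 v)) H)
      \<le> C / (1 + v^2) / (\<bar>v\<bar> - \<bar>Im l\<bar>) * norm (Complex x2 v - Complex x1 v)"
    proof (rule has_contour_integral_bound_linepath)
      show "0 \<le> C / (1 + v^2) / (\<bar>v\<bar> - \<bar>Im l\<bar>)"
        using C0 v by (auto intro!: divide_nonneg_pos divide_nonneg_nonneg)
      fix z assume "z \<in> closed_segment (Complex x1 v) (Complex x2 v)"
      then have z: "p \<le> Re z" "Re z \<le> q" "Im z = v" using seg by auto
      have "\<bar>v\<bar> - \<bar>Im l\<bar> \<le> norm (z - l)"
        using abs_Im_le_cmod[of "z - l"] z by simp
      then show "norm (H z) \<le> C / (1 + v^2) / (\<bar>v\<bar> - \<bar>Im l\<bar>)"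
        unfolding H_def norm_divide using bnd[of z] z v C0 by (intro frac_le) auto
    qed
    also have "norm (Complex x2 v - Complex x1 v) = q - p"
      using x pq by (auto simp: doubleton_eq_iff cmod_def)
    finally show ?thesis .
  qed
  have lim0: "(\<lambda>n. C / (1 + (real n)^2) / (\<bar>real n\<bar> - \<bar>Im l\<bar>) * (q - p)) \<longlonglongrightarrow> 0"
    by real_asymp
  have T0: "T \<longlonglongrightarrow> 0"
    by (rule Lim_null_comparison[OF _ lim0], rule eventually_mono[OF eventually_ge_at_top[of N]])
      (use horiz[of "- real _" p q] Nl in \<open>auto simp: T_def\<close>)
  have U0: "U \<longlonglongrightarrow> 0"
    by (rule Lim_null_comparison[OF _ lim0], rule eventually_mono[OF eventually_ge_at_top[of N]])
      (use horiz[of "real _" q p] Nl in \<open>auto simp: U_def insert_commute\<close>)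
  have Hp: "integrable lborel (\<lambda>w. H (Complex p w))" "integrable lborel (\<lambda>w. H (Complex q w))"
    using integrable_minus[OF integrable_cauchy_kernel[OF int(1), of l]]
      integrable_minus[OF integrable_cauchy_kernel[OF int(2), of l]] l
    by (simp_all add: H_def flip: divide_minus_right)
  have "(\<lambda>n. T n + \<i> * integral {- real n..real n} (\<lambda>w. H (Complex q w)) + U n
      - \<i> * integral {- real n..real n} (\<lambda>w. H (Complex p w))) \<longlonglongrightarrow>
      0 + \<i> * (\<integral>w. H (Complex q w) \<partial>lborel) + 0 - \<i> * (\<integral>w. H (Complex p w) \<partial>lborel)"
    by (intro tendsto_intros T0 U0 tendsto_integral_symmetric Hp)
  moreover have "(\<lambda>n. T n + \<i> * integral {- real n..real n} (\<lambda>w. H (Complex q w)) + U n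
      - \<i> * integral {- real n..real n} (\<lambda>w. H (Complex p w))) \<longlonglongrightarrow> 2 * pi * \<i> * G l"
    by (rule tendsto_eventually, rule eventually_mono[OF eventually_ge_at_top[of N]]) (use eq in auto)
  ultimately have "\<i> * (\<integral>w. H (Complex q w) \<partial>lborel) - \<i> * (\<integral>w. H (Complex p w) \<partial>lborel) = 2 * pi * \<i> * G l"
    using LIMSEQ_unique by fastforce
  then have "\<i> * ((\<integral>w. H (Complex q w) \<partial>lborel) - (\<integral>w. H (Complex p w) \<partial>lborel)) = \<i> * (2 * pi * G l)"
    by (simp add: algebra_simps)
  then have main: "(\<integral>w. H (Complex q w) \<partial>lborel) - (\<integral>w. H (Complex p w) \<partial>lborel) = 2 * pi * G l"
    by (simp only: mult_cancel_left) simp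
  \<comment> \<open>\<open>H\<close> has the kernel \<open>1 / (z - l)\<close>, whereas the Cauchy
    transforms are written with \<open>1 / (l - z)\<close>.\<close>
  have neg: "(\<integral>w. G (Complex x w) / (l - Complex x w) \<partial>lborel) = - (\<integral>w. H (Complex x w) \<partial>lborel)" for x
    by (simp add: H_def flip: Bochner_Integration.integral_minus divide_minus_right)
  show ?thesis using main unfolding neg by (simp add: algebra_simps)
qed

section \<open>Fourier integrals: continuity, derivative and Laplace transform\<close>

lemma norm_cis_minus_one_le: "norm (cis x - 1) \<le> \<bar>x\<bar>"
  using iexp_approx1[of x 0] by (simp add: cis_conv_exp)

lemma norm_cis_diff_le: "norm (cis x - cis y) \<le> \<bar>x - y\<bar>"
proof -
  have "cis x - cis y = cis y * (cis (x - y) - 1)"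
    by (simp add: algebra_simps cis_mult)
  then show ?thesis
    using norm_cis_minus_one_le[of "x - y"] by (simp add: norm_mult)
qed

lemma borel_measurable_cis [measurable]: "cis \<in> borel_measurable borel"
  by (intro borel_measurable_continuous_onI continuous_intros)

lemma integrable_mult_cis:
  assumes "integrable lborel g"
  shows "integrable lborel (\<lambda>w. g w * cis (w * t))"
proof (rule Bochner_Integration.integrable_bound[OF assms])
  have [measurable]: "g \<in> borel_measurable borel"
    using assms by auto
  show "(\<lambda>w. g w * cis (w * t)) \<in> borel_measurable lborel" by measurable
qed (auto simp: norm_mult)

lemma norm_fourier_integral_le:
  "integrable lborel g \<Longrightarrow> norm (\<integral>w. g w * cis (w * t) \<partial>lborel) \<le> (\<integral>w. norm (g w) \<partial>lborel)"
  using integral_norm_bound[of lborel "\<lambda>w. g w * cis (w * t)"] by (simp add: norm_mult)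

text \<open>Dominated convergence along two sequences whose distance tends to \<open>0\<close>; the
  estimate \<open>norm_cis_diff_le\<close> sees only that distance and not the position of the
  points. It serves for the derivative of a Fourier integral.\<close>

lemma uniformly_continuous_on_fourier_integral:
  assumes g: "integrable lborel g"
  shows "uniformly_continuous_on S (\<lambda>t. \<integral>w. g w * cis (w * t) \<partial>lborel)"
  unfolding uniformly_continuous_on_sequentially
proof (intro allI impI, elim conjE)
  fix x y :: "nat \<Rightarrow> real"
  assume xy: "(\<lambda>n. dist (x n) (y n)) \<longlonglongrightarrow> 0"
  have [measurable]: "g \<in> borel_measurable borel"
    using g by auto
  have "(\<lambda>n. \<integral>w. g w * cis (w * x n) - g w * cis (w * y n) \<partial>lborel) \<longlonglongrightarrow> (\<integral>w. 0 \<partial>(lborel :: real measure))"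
  proof (rule integral_dominated_convergence)
    show "integrable lborel (\<lambda>w. 2 * norm (g w))"
      using g by simp
    show "AE w in lborel. norm (g w * cis (w * x n) - g w * cis (w * y n)) \<le> 2 * norm (g w)" for n
      by (intro AE_I2 order_trans[OF norm_triangle_ineq4]) (simp add: norm_mult)
    show "AE w in lborel. (\<lambda>n. g w * cis (w * x n) - g w * cis (w * y n)) \<longlonglongrightarrow> 0"
    proof (intro AE_I2 Lim_null_comparison[where f = "\<lambda>n. g _ * cis (_ * x n) - g _ * cis (_ * y n)"] always_eventually allI)
      fix w n
      have "norm (g w * (cis (w * x n) - cis (w * y n))) \<le> norm (g w) * \<bar>w * x n - w * y n\<bar>"
        unfolding norm_mult by (intro mult_left_mono norm_cis_diff_le) simp
      then show "norm (g w * cis (w * x n) - g w * cis (w * y n)) \<le> norm (g w) * (\<bar>w\<bar> * dist (x n) (y n))"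
        by (simp add: algebra_simps dist_real_def flip: abs_mult)
    next
      show "(\<lambda>n. norm (g w) * (\<bar>w\<bar> * dist (x n) (y n))) \<longlonglongrightarrow> 0" for w
        using xy by (intro tendsto_mult_right_zero)
    qed
  qed auto
  then have "(\<lambda>n. norm ((\<integral>w. g w * cis (w * x n) \<partial>lborel) - (\<integral>w. g w * cis (w * y n) \<partial>lborel))) \<longlonglongrightarrow> 0"
    using integrable_mult_cis[OF g] by (simp add: tendsto_norm_zero_iff)
  then show "(\<lambda>n. dist (\<integral>w. g w * cis (w * x n) \<partial>lborel) (\<integral>w. g w * cis (w * y n) \<partial>lborel)) \<longlonglongrightarrow> 0"
    by (simp add: dist_norm)
qed

text \<open>In quotient form the derivative can be tested along sequences, as dominated convergence
  requires.\<close>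

lemma has_vector_derivative_at_iff_quotient:
  "(f has_vector_derivative D) (at t) \<longleftrightarrow> ((\<lambda>h. (f (t + h) - f t) /\<^sub>R h) \<longlongrightarrow> D) (at 0)"
proof -
  have "(f has_vector_derivative D) (at t) \<longleftrightarrow>
      ((\<lambda>h. norm (f (t + h) - f t - h *\<^sub>R D) / norm h) \<longlongrightarrow> 0) (at 0)"
    by (simp add: has_vector_derivative_def has_derivative_at bounded_linear_scaleR_left)
  also have "\<dots> \<longleftrightarrow> ((\<lambda>h. norm ((f (t + h) - f t) /\<^sub>R h - D)) \<longlongrightarrow> 0) (at 0)"
  proof (intro filterlim_cong refl eventually_mono[OF eventually_at_ball'[of 1]])
    fix h :: real assume "h \<in> ball 0 1 \<and> h \<noteq> 0 \<and> h \<in> UNIV"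
    then have "(f (t + h) - f t) /\<^sub>R h - D = (f (t + h) - f t - h *\<^sub>R D) /\<^sub>R h"
      by (simp add: algebra_simps)
    then show "norm (f (t + h) - f t - h *\<^sub>R D) / norm h = norm ((f (t + h) - f t) /\<^sub>R h - D)"
      by (simp add: divide_inverse)
  qed simp
  finally show ?thesis
    by (simp add: tendsto_norm_zero_iff LIM_zero_iff)
qed

text \<open>Differentiation under the integral sign: by \<open>norm_cis_minus_one_le\<close> every
  difference quotient of the integrand is dominated by
  \<open>norm (\<i> * of_real w * g w)\<close>.\<close>

lemma has_vector_derivative_fourier_integral:
  assumes g: "integrable lborel g" and wg: "integrable lborel (\<lambda>w. \<i> * of_real w * g w)"
  shows "((\<lambda>t. \<integral>w. g w * cis (w * t) \<partial>lborel) has_vector_derivative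
    (\<integral>w. (\<i> * of_real w * g w) * cis (w * t) \<partial>lborel)) (at t)"
proof -
  have [measurable]: "g \<in> borel_measurable borel"
    using g by auto
  define f where "f t = (\<integral>w. g w * cis (w * t) \<partial>lborel)" for t
  define D where "D = (\<integral>w. (\<i> * of_real w * g w) * cis (w * t) \<partial>lborel)"
  have "((\<lambda>h. (f (t + h) - f t) /\<^sub>R h) \<longlongrightarrow> D) (at 0)"
    unfolding tendsto_at_iff_sequentially
  proof (intro allI impI)
    fix X :: "nat \<Rightarrow> real"
    assume X: "\<forall>n. X n \<in> UNIV - {0}" "X \<longlonglongrightarrow> 0"
    have eq: "g w * cis (w * (t + X n)) - g w * cis (w * t) = g w * cis (w * t) * (cis (w * X n) - 1)" for w n
      by (simp add: algebra_simps cis_mult)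
    have "(\<lambda>n. \<integral>w. (g w * cis (w * (t + X n)) - g w * cis (w * t)) /\<^sub>R X n \<partial>lborel) \<longlonglongrightarrow> D"
      unfolding D_def
    proof (rule integral_dominated_convergence)
      show "integrable lborel (\<lambda>w. norm (\<i> * of_real w * g w))"
        using wg by (rule integrable_norm)
      show "AE w in lborel. norm ((g w * cis (w * (t + X n)) - g w * cis (w * t)) /\<^sub>R X n) \<le> norm (\<i> * of_real w * g w)" for n
      proof (intro AE_I2)
        fix w
        have "norm ((g w * cis (w * (t + X n)) - g w * cis (w * t)) /\<^sub>R X n) = norm (g w) * norm (cis (w * X n) - 1) / \<bar>X n\<bar>"
          unfolding eq by (simp add: norm_mult divide_inverse)
        also have "\<dots> \<le> norm (g w) * \<bar>w * X n\<bar> / \<bar>X n\<bar>"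
          by (intro divide_right_mono mult_left_mono norm_cis_minus_one_le) auto
        also have "\<dots> = norm (\<i> * of_real w * g w)"
          using X(1) by (simp add: norm_mult abs_mult)
        finally show "norm ((g w * cis (w * (t + X n)) - g w * cis (w * t)) /\<^sub>R X n) \<le> norm (\<i> * of_real w * g w)" .
      qed
      show "AE w in lborel. (\<lambda>n. (g w * cis (w * (t + X n)) - g w * cis (w * t)) /\<^sub>R X n) \<longlonglongrightarrow> (\<i> * of_real w * g w) * cis (w * t)"
      proof (intro AE_I2)
        fix w
        have "((\<lambda>t. g w * cis (w * t)) has_vector_derivative (g w * (\<i> * of_real w * cis (w * t)))) (at t)"
          unfolding cis_conv_exp of_real_mult
          by (rule has_vector_derivative_real_field[where f = "\<lambda>z. g w * exp (\<i> * (of_real w * z))"])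
            (auto intro!: derivative_eq_intros)
        then have "((\<lambda>h. (g w * cis (w * (t + h)) - g w * cis (w * t)) /\<^sub>R h) \<longlongrightarrow> (g w * (\<i> * of_real w * cis (w * t)))) (at 0)"
          unfolding has_vector_derivative_at_iff_quotient .
        then show "(\<lambda>n. (g w * cis (w * (t + X n)) - g w * cis (w * t)) /\<^sub>R X n) \<longlonglongrightarrow> (\<i> * of_real w * g w) * cis (w * t)"
          using X unfolding tendsto_at_iff_sequentially by (auto simp: o_def mult_ac)
      qed
    qed auto
    moreover have "(\<integral>w. (g w * cis (w * (t + X n)) - g w * cis (w * t)) /\<^sub>R X n \<partial>lborel) = (f (t + X n) - f t) /\<^sub>R X n" for n
      unfolding f_def using integrable_mult_cis[OF g] by simp
    ultimately show "((\<lambda>h. (f (t + h) - f t) /\<^sub>R h) \<circ> X) \<longlonglongrightarrow> D"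
      by (simp only: o_def)
  qed
  then show ?thesis
    unfolding has_vector_derivative_at_iff_quotient f_def D_def .
qed

lemma
  assumes l: "Re l > 0"
  shows integrable_exp_Ici: "set_integrable lborel {0..} (\<lambda>t. exp (- l * complex_of_real t))"
    and integral_exp_Ici: "(LBINT t:{0..}. exp (- l * complex_of_real t)) = 1 / l"
proof -
  \<comment> \<open>The exponential integrals are computed on the open half-line; the endpoint
    \<open>0\<close> is a null set.\<close>
  have AE0: "AE t in lborel. t \<noteq> (0::real)"
    by (rule AE_lborel_singleton)
  have "set_integrable lborel {0<..} (\<lambda>t. exp (- (t * Re l)))"
    using integrable_I0i_exp_mscale[OF l] .
  then have int0: "set_integrable lborel {0<..} (\<lambda>t. exp (- l * complex_of_real t))"
    unfolding set_integrable_def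
    by (rule Bochner_Integration.integrable_bound) (auto simp: mult_ac)
  then show int: "set_integrable lborel {0..} (\<lambda>t. exp (- l * complex_of_real t))"
    unfolding set_integrable_def
    by (rule integrable_cong_AE_imp) (use AE0 in \<open>auto elim!: eventually_mono simp: indicator_def\<close>)
  have "(LBINT t:{0..}. exp (- l * complex_of_real t)) = (LBINT t:{0<..}. exp (- l * complex_of_real t))"
    unfolding set_lebesgue_integral_def
    by (rule integral_cong_AE) (use AE0 in \<open>auto elim!: eventually_mono simp: indicator_def\<close>)
  also have "\<dots> = (LBINT t=0..\<infinity>. exp (- l * complex_of_real t))"
    by (simp add: interval_lebesgue_integral_def zero_ereal_def)
  also have "\<dots> = 0 - (- 1 / l)"
  proof (rule interval_integral_FTC_integrable[where F = "\<lambda>t. - exp (- l * complex_of_real t) / l"])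
    show "((\<lambda>t. - exp (- l * complex_of_real t) / l) has_vector_derivative exp (- l * complex_of_real x)) (at x)" for x
      using l
      by (intro has_vector_derivative_real_field[where f = "\<lambda>z. - exp (- l * z) / l"])
        (auto intro!: derivative_eq_intros)
    show "set_integrable lborel (einterval 0 \<infinity>) (\<lambda>t. exp (- l * complex_of_real t))"
      using int0 by (simp add: zero_ereal_def)
    have "((\<lambda>t. - exp (- l * complex_of_real t) / l) \<longlongrightarrow> - exp (- l * complex_of_real 0) / l) (at_right 0)"
      using l by (intro tendsto_intros) auto
    then show "(((\<lambda>t. - exp (- l * complex_of_real t) / l) \<circ> real_of_ereal) \<longlongrightarrow> - 1 / l) (at_right 0)"
      by (simp add: ereal_tendsto_simps zero_ereal_def)
    have "norm l > 0" using l by auto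
    then have "((\<lambda>t. exp (- (Re l * t)) / norm l) \<longlongrightarrow> 0) at_top"
      using l by real_asymp
    then have "((\<lambda>t. - exp (- l * complex_of_real t) / l) \<longlongrightarrow> 0) at_top"
      by (rule Lim_null_comparison[rotated]) (simp add: norm_divide)
    then show "(((\<lambda>t. - exp (- l * complex_of_real t) / l) \<circ> real_of_ereal) \<longlongrightarrow> 0) (at_left \<infinity>)"
      by (simp add: ereal_tendsto_simps)
  qed (auto intro!: continuous_intros)
  finally show "(LBINT t:{0..}. exp (- l * complex_of_real t)) = 1 / l"
    by simp
qed

text \<open>Fubini: in absolute value the integrand is the product of \<open>norm (e t)\<close> and
  \<open>norm (g w)\<close>. The inner integral in \<open>t\<close> is the Laplace transform of a
  character, with exponent \<open>l - Complex 0 w\<close> of positive real part.\<close>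

lemma laplace_transform_fourier_integral:
  assumes g: "integrable lborel g" and l: "Re l > 0"
  shows "laplace_transform (\<lambda>t. \<integral>w. g w * cis (w * t) \<partial>lborel) l
    = (\<integral>w. g w / (l - Complex 0 w) \<partial>lborel)"
proof -
  have [measurable]: "g \<in> borel_measurable borel"
    using g by auto
  define e where "e t = indicator {0..} t *\<^sub>R exp (- l * complex_of_real t)" for t
  have [measurable]: "e \<in> borel_measurable borel"
    unfolding e_def by measurable
  have e: "integrable lborel e"
    using integrable_exp_Ici[OF l] unfolding set_integrable_def e_def .
  have I: "integrable (lborel \<Otimes>\<^sub>M lborel) (\<lambda>(t, w). e t * (g w * cis (w * t)))"
  proof (rule lborel_pair.Fubini_integrable)
    show "(\<lambda>(t, w). e t * (g w * cis (w * t))) \<in> borel_measurable (lborel \<Otimes>\<^sub>M lborel)"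
      by measurable
    show "integrable lborel (\<lambda>t. \<integral>w. norm (case (t, w) of (t, w) \<Rightarrow> e t * (g w * cis (w * t))) \<partial>lborel)"
      using e by (simp add: norm_mult)
    show "AE t in lborel. integrable lborel (\<lambda>w. case (t, w) of (t, w) \<Rightarrow> e t * (g w * cis (w * t)))"
      using integrable_mult_cis[OF g] by simp
  qed
  have "laplace_transform (\<lambda>t. \<integral>w. g w * cis (w * t) \<partial>lborel) l
      = (\<integral>t. (\<integral>w. e t * (g w * cis (w * t)) \<partial>lborel) \<partial>lborel)"
    unfolding laplace_transform_def set_lebesgue_integral_def e_def by simp
  also have "\<dots> = (\<integral>w. (\<integral>t. e t * (g w * cis (w * t)) \<partial>lborel) \<partial>lborel)"
    by (rule lborel_pair.Fubini_integral[OF I, symmetric])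
  also have "\<dots> = (\<integral>w. g w / (l - Complex 0 w) \<partial>lborel)"
  proof (rule Bochner_Integration.integral_cong[OF refl])
    fix w
    have "e t * (g w * cis (w * t)) = g w * (indicator {0..} t *\<^sub>R exp (- (l - Complex 0 w) * complex_of_real t))" for t
    proof -
      have "exp (- (l - Complex 0 w) * complex_of_real t) = exp (- l * complex_of_real t) * cis (w * t)"
        unfolding cis_conv_exp
        by (subst exp_add[symmetric], rule arg_cong[where f = exp]) (simp add: complex_eq_iff algebra_simps)
      then show ?thesis by (simp add: e_def)
    qed
    then have "(\<integral>t. e t * (g w * cis (w * t)) \<partial>lborel)
        = g w * (LBINT t:{0..}. exp (- (l - Complex 0 w) * complex_of_real t))"
      unfolding set_lebesgue_integral_def by (simp only: integral_mult_right_zero)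
    then show "(\<integral>t. e t * (g w * cis (w * t)) \<partial>lborel) = g w / (l - Complex 0 w)"
      using integral_exp_Ici[of "l - Complex 0 w"] l by simp
  qed
  finally show ?thesis .
qed

section \<open>Admissibility of Fourier integrals along the imaginary axis\<close>

text \<open>The factor \<open>z\<close> costs only a weight on \<open>g\<close>:
  \<open>norm z\<close> is at most the distance \<open>D\<close> to the point
  \<open>Complex c w\<close> plus the modulus of that point, so \<open>norm z / D\<close> is bounded
  by a constant times \<open>1 + \<bar>w\<bar>\<close> as long as
  \<open>D \<ge> \<delta>\<close>.\<close>

lemma norm_mult_cauchy_transform_le:
  fixes g :: "real \<Rightarrow> complex"
  assumes h: "integrable lborel h" and g: "g \<in> borel_measurable borel"
    and gh: "\<And>w. (1 + \<bar>w\<bar>) * norm (g w) \<le> h w"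
    and c: "c \<ge> 0" and \<delta>: "\<delta> > 0" "\<bar>Re z - c\<bar> \<ge> \<delta>"
  shows "norm (z * (\<integral>w. g w / (z - Complex c w) \<partial>lborel)) \<le> (1 + (c + 1) / \<delta>) * (\<integral>w. h w \<partial>lborel)"
proof -
  note [measurable] = g
  have "z * (\<integral>w. g w / (z - Complex c w) \<partial>lborel) = (\<integral>w. z * (g w / (z - Complex c w)) \<partial>lborel)"
    by (rule integral_mult_right_zero[symmetric])
  also have "norm \<dots> \<le> (\<integral>w. (1 + (c + 1) / \<delta>) * h w \<partial>lborel)"
  proof (rule integral_norm_bound_nonneg)
    show "integrable lborel (\<lambda>w. (1 + (c + 1) / \<delta>) * h w)"
      using h by simp
    fix w
    define D where "D = norm (z - Complex c w)"
    have D: "D \<ge> \<delta>"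
      using norm_diff_Complex_ge[of z c w] \<delta> by (simp add: D_def)
    have "norm z \<le> D + norm (Complex c w)"
      unfolding D_def by norm
    also have "norm (Complex c w) \<le> c + \<bar>w\<bar>"
      using cmod_le[of "Complex c w"] c by simp
    also have "c + \<bar>w\<bar> \<le> (c + 1) * (1 + \<bar>w\<bar>)"
      using c by (simp add: algebra_simps)
    finally have z: "norm z \<le> D + (c + 1) * (1 + \<bar>w\<bar>)" by simp
    have "norm z / D \<le> 1 + (c + 1) * (1 + \<bar>w\<bar>) / D"
      using z D \<delta> by (simp add: field_simps)
    also have "\<dots> \<le> 1 + (c + 1) * (1 + \<bar>w\<bar>) / \<delta>"
      using D \<delta> c by (intro add_left_mono divide_left_mono) auto
    also have "\<dots> \<le> (1 + (c + 1) / \<delta>) * (1 + \<bar>w\<bar>)"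
      using \<delta> c by (simp add: field_simps)
    finally have "norm z / D * norm (g w) \<le> (1 + (c + 1) / \<delta>) * (1 + \<bar>w\<bar>) * norm (g w)"
      by (intro mult_right_mono) auto
    also have "\<dots> = (1 + (c + 1) / \<delta>) * ((1 + \<bar>w\<bar>) * norm (g w))"
      by (simp add: mult.assoc)
    also have "\<dots> \<le> (1 + (c + 1) / \<delta>) * h w"
      using \<delta> c by (intro mult_left_mono gh) auto
    finally show "norm (z * (g w / (z - Complex c w))) \<le> (1 + (c + 1) / \<delta>) * h w"
      by (simp add: norm_mult norm_divide D_def)
  qed measurable
  finally show ?thesis by simp
qed

lemma open_Omega:
  assumes M: "\<And>s. s \<ge> 0 \<Longrightarrow> M s > 0" and cont: "continuous_on {0..} M"
  shows "open (Omega M)"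
proof -
  have "continuous_on UNIV (\<lambda>z. M \<bar>Im z\<bar>)"
    by (rule continuous_on_compose2[OF cont]) (auto intro!: continuous_intros)
  moreover have "M \<bar>Im z\<bar> \<noteq> 0" for z
    using M[of "\<bar>Im z\<bar>"] by simp
  ultimately show ?thesis
    unfolding Omega_def by (intro open_Collect_less continuous_intros) auto
qed

lemma Re_nonneg_in_Omega:
  assumes "\<And>s. s \<ge> 0 \<Longrightarrow> M s > 0" "Re z \<ge> 0"
  shows "z \<in> Omega M"
  using assms(1)[of "\<bar>Im z\<bar>"] assms(2) 
  by (simp add: Omega_def) (smt (verit) divide_pos_pos)

text \<open>The Laplace transform of the Fourier integral of \<open>G\<close> along the imaginary axis
  is the Cauchy transform of \<open>G\<close> along that axis; moving the contour to \<open>Re z = a\<close> picks up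
  the residue \<open>2 \<pi> G\<close> and yields the extension to the left half-plane.\<close>

lemma admissible_fourier_integral:
  fixes G :: "complex \<Rightarrow> complex" and M K :: "real \<Rightarrow> real"
  assumes M: "\<And>s. s \<ge> 0 \<Longrightarrow> M s > 0" "continuous_on {0..} M"
    and K: "\<And>s. s \<ge> 0 \<Longrightarrow> K s > 0" "mono_on {0..} K"
    and ab: "0 < a" "a < b"
    and hol: "G holomorphic_on (Omega M \<inter> {z. Re z < b})"
    and GK: "\<And>z. z \<in> Omega M \<Longrightarrow> Re z \<le> a \<Longrightarrow> norm z * norm (G z) \<le> C * K \<bar>Im z\<bar>"
    and quad: "\<And>z. 0 \<le> Re z \<Longrightarrow> Re z \<le> a \<Longrightarrow> norm (G z) \<le> C' / (1 + (Im z)^2)"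
    and h: "integrable lborel h"
    and Gh: "\<And>z. 0 \<le> Re z \<Longrightarrow> Re z \<le> a \<Longrightarrow> (1 + \<bar>Im z\<bar>) * norm (G z) \<le> h (Im z)"
  shows "admissible M K (\<lambda>t. \<integral>w. G (Complex 0 w) * cis (w * t) \<partial>lborel)"
proof -
  have line: "continuous_on UNIV (\<lambda>w. G (Complex c w))" if "0 \<le> c" "c \<le> a" for c
  proof (rule continuous_on_compose2[OF holomorphic_on_imp_continuous_on[OF hol]])
    have "Complex c = (\<lambda>w. of_real c + \<i> * of_real w)"
      by (auto simp: complex_eq_iff)
    then show "continuous_on UNIV (Complex c)"
      by (auto intro!: continuous_intros)
    show "range (Complex c) \<subseteq> Omega M \<inter> {z. Re z < b}"
      using that ab Re_nonneg_in_Omega[OF M(1)] by auto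
  qed
  have meas: "(\<lambda>w. G (Complex c w)) \<in> borel_measurable borel" if "0 \<le> c" "c \<le> a" for c
    by (rule borel_measurable_continuous_onI[OF line[OF that]])
  have Gh': "(1 + \<bar>w\<bar>) * norm (G (Complex c w)) \<le> h w" if "0 \<le> c" "c \<le> a" for c w
    using Gh[of "Complex c w"] that by simp
  have h0: "0 \<le> h w" for w
    using Gh'[of 0 w] ab by (meson abs_ge_zero add_nonneg_nonneg less_eq_real_def mult_nonneg_nonneg norm_ge_zero order_trans zero_le_one)
  have int: "integrable lborel (\<lambda>w. G (Complex c w))" if c: "0 \<le> c" "c \<le> a" for c
  proof (rule Bochner_Integration.integrable_bound[OF h])
    show "(\<lambda>w. G (Complex c w)) \<in> borel_measurable lborel"
      using meas[OF c] by simp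
    have "norm (G (Complex c w)) \<le> (1 + \<bar>w\<bar>) * norm (G (Complex c w))" for w
      by (simp add: algebra_simps)
    then show "AE w in lborel. norm (G (Complex c w)) \<le> norm (h w)"
      using Gh'[OF c] h0 by (intro AE_I2) (metis abs_of_nonneg order_trans real_norm_def)
  qed
  define g where "g w = G (Complex 0 w)" for w
  have g: "integrable lborel g"
    unfolding g_def using int[of 0] ab by simp
  have [measurable]: "g \<in> borel_measurable borel" using g by auto
  have wg: "integrable lborel (\<lambda>w. \<i> * of_real w * g w)"
  proof (rule Bochner_Integration.integrable_bound[OF h])
    have "norm (\<i> * of_real w * g w) \<le> (1 + \<bar>w\<bar>) * norm (g w)" for w
      by (simp add: norm_mult mult_right_mono)
    then show "AE w in lborel. norm (\<i> * of_real w * g w) \<le> norm (h w)"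
      using Gh'[of 0] h0 ab unfolding g_def
      by (intro AE_I2) (metis abs_of_nonneg order_trans real_norm_def less_eq_real_def)
  qed measurable
  define f where "f t = (\<integral>w. g w * cis (w * t) \<partial>lborel)" for t
  define f' where "f' t = (\<integral>w. (\<i> * of_real w * g w) * cis (w * t) \<partial>lborel)" for t
  have der: "(f has_vector_derivative f' t) (at t within T)" for t T
    using has_vector_derivative_fourier_integral[OF g wg, of t] unfolding f_def f'_def
    by (rule has_vector_derivative_at_within)
  have bdd: "bounded (f ` {0..})"
    using norm_fourier_integral_le[OF g] unfolding f_def bounded_iff by blast
  have lip: "(\<integral>w. norm (\<i> * of_real w * g w) \<partial>lborel)-lipschitz_on {0..} f"
  proof (rule bounded_derivative_imp_lipschitz)
    show "(f has_derivative (\<lambda>x. x *\<^sub>R f' t)) (at t within {0..})" for t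
      using der[of t "{0..}"] by (simp add: has_vector_derivative_def)
    show "onorm (\<lambda>x. x *\<^sub>R f' t) \<le> (\<integral>w. norm (\<i> * of_real w * g w) \<partial>lborel)" for t
    proof (rule onorm_le)
      fix x :: real
      have "norm (f' t) \<le> (\<integral>w. norm (\<i> * of_real w * g w) \<partial>lborel)"
        unfolding f'_def by (rule norm_fourier_integral_le[OF wg])
      then show "norm (x *\<^sub>R f' t) \<le> (\<integral>w. norm (\<i> * of_real w * g w) \<partial>lborel) * norm x"
        by (simp only: norm_scaleR real_norm_def mult.commute[of "\<bar>x\<bar>"] mult_right_mono[OF _ abs_ge_zero])
    qed
  qed auto
  \<comment> \<open>\<open>F0\<close> is the Laplace transform to the right of the axis, while
    \<open>Fa\<close> makes sense in \<open>Omega M\<close> to the left of \<open>Re z = a\<close>.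
    They agree for \<open>0 < Re z < a\<close>, so the two pieces glue to one function on
    \<open>Omega M\<close>.\<close>
  define F0 where "F0 z = (\<integral>w. G (Complex 0 w) / (z - Complex 0 w) \<partial>lborel)" for z
  define Fa where "Fa z = 2 * pi * G z + (\<integral>w. G (Complex a w) / (z - Complex a w) \<partial>lborel)" for z
  define F where "F z = (if Re z > 0 then F0 z else Fa z)" for z
  have eq: "F0 z = Fa z" if "0 < Re z" "Re z < a" for z
    unfolding F0_def Fa_def
  proof (rule cauchy_formula_strip[where C = C'])
    show "G holomorphic_on {z. 0 \<le> Re z \<and> Re z \<le> a}"
      using ab Re_nonneg_in_Omega[OF M(1)] by (intro holomorphic_on_subset[OF hol]) auto
  qed (use that ab quad int in auto)
  have oO: "open (Omega M)" by (rule open_Omega[OF M])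
  have "F0 holomorphic_on {z. Re z \<noteq> 0}"
    unfolding F0_def by (rule holomorphic_on_cauchy_transform) (use int[of 0] ab in auto)
  then have "F0 holomorphic_on (Omega M \<inter> {z. Re z > 0})"
    by (rule holomorphic_on_subset) auto
  then have h1: "F holomorphic_on (Omega M \<inter> {z. Re z > 0})"
    by (rule holomorphic_transform) (auto simp: F_def)
  have "(\<lambda>z. \<integral>w. G (Complex a w) / (z - Complex a w) \<partial>lborel) holomorphic_on {z. Re z \<noteq> a}"
    by (rule holomorphic_on_cauchy_transform) (use int[of a] ab in auto)
  then have "(\<lambda>z. \<integral>w. G (Complex a w) / (z - Complex a w) \<partial>lborel) holomorphic_on (Omega M \<inter> {z. Re z < a})"
    by (rule holomorphic_on_subset) auto
  moreover have "G holomorphic_on (Omega M \<inter> {z. Re z < a})"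
    using ab by (intro holomorphic_on_subset[OF hol]) auto
  ultimately have "Fa holomorphic_on (Omega M \<inter> {z. Re z < a})"
    unfolding Fa_def by (intro holomorphic_intros)
  then have h2: "F holomorphic_on (Omega M \<inter> {z. Re z < a})"
    by (rule holomorphic_transform) (use eq in \<open>auto simp: F_def\<close>)
  have "F holomorphic_on ((Omega M \<inter> {z. Re z > 0}) \<union> (Omega M \<inter> {z. Re z < a}))"
    using h1 h2 oO by (intro holomorphic_on_Un open_Int open_halfspace_Re_gt open_halfspace_Re_lt)
  moreover have "(Omega M \<inter> {z. Re z > 0}) \<union> (Omega M \<inter> {z. Re z < a}) = Omega M"
    using ab by auto
  ultimately have "F analytic_on Omega M"
    using oO by (simp add: analytic_on_open)
  moreover have "F z = laplace_transform f z" if "Re z > 0" for z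
    using laplace_transform_fourier_integral[OF g that] that
    by (simp add: F_def F0_def f_def[abs_def] g_def)
  moreover have "bdd_above ((\<lambda>z. norm (z * F z) / K \<bar>Im z\<bar>) ` Omega M)"
  proof -
    \<comment> \<open>The bound for the Cauchy transform along \<open>Re z = a\<close> at distance
      \<open>a / 2\<close>; it also dominates the one along the imaginary axis.\<close>
    define B where "B = (1 + (a + 1) / (a / 2)) * (\<integral>w. h w \<partial>lborel)"
    have I0: "0 \<le> (\<integral>w. h w \<partial>lborel)"
      using h0 by simp
    then have B0: "0 \<le> B" using ab by (simp add: B_def)
    have C0: "0 \<le> C"
    proof -
      have "0 \<le> C * K 0"
        using GK[of 0] Re_nonneg_in_Omega[OF M(1), where z = 0] ab by simp
      then show ?thesis using K(1)[of 0] by (simp add: zero_le_mult_iff)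
    qed
    \<comment> \<open>Splitting at \<open>Re z = a / 2\<close> keeps \<open>z\<close> at distance at
      least \<open>a / 2\<close> from the line of whichever Cauchy transform is in use.\<close>
    have "norm (z * F z) \<le> 2 * pi * (C * K \<bar>Im z\<bar>) + B" if z: "z \<in> Omega M" for z
    proof (cases "Re z \<le> a / 2")
      case True
      then have "F z = Fa z"
        using eq[of z] ab by (auto simp: F_def)
      then have "norm (z * F z) \<le> norm (z * (2 * pi * G z)) +
          norm (z * (\<integral>w. G (Complex a w) / (z - Complex a w) \<partial>lborel))"
        unfolding Fa_def by (simp only: distrib_left norm_triangle_ineq)
      also have "norm (z * (2 * pi * G z)) = 2 * pi * (norm z * norm (G z))"
        by (simp add: norm_mult)
      also have "\<dots> \<le> 2 * pi * (C * K \<bar>Im z\<bar>)"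
        using True ab by (intro mult_left_mono GK z) auto
      also have "norm (z * (\<integral>w. G (Complex a w) / (z - Complex a w) \<partial>lborel)) \<le> B"
        unfolding B_def using ab True
        by (intro norm_mult_cauchy_transform_le[OF h meas] Gh') auto
      finally show ?thesis by simp
    next
      case False
      then have "F z = F0 z" using ab by (simp add: F_def)
      then have "norm (z * F z) \<le> (1 + (0 + 1) / (a / 2)) * (\<integral>w. h w \<partial>lborel)"
        unfolding F0_def using ab False
        by (simp only:, intro norm_mult_cauchy_transform_le[OF h meas] Gh') auto
      also have "\<dots> \<le> B"
        unfolding B_def using ab I0 by (intro mult_right_mono add_left_mono divide_right_mono) auto
      also have "B \<le> 2 * pi * (C * K \<bar>Im z\<bar>) + B"
        using C0 K(1)[of "\<bar>Im z\<bar>"] by simp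
      finally show ?thesis .
    qed
    then have "norm (z * F z) / K \<bar>Im z\<bar> \<le> 2 * pi * C + B / K 0" if z: "z \<in> Omega M" for z
    proof -
      have K0: "K 0 > 0" "K \<bar>Im z\<bar> > 0" "K 0 \<le> K \<bar>Im z\<bar>"
        using K by (auto intro: mono_onD)
      have "norm (z * F z) / K \<bar>Im z\<bar> \<le> (2 * pi * (C * K \<bar>Im z\<bar>) + B) / K \<bar>Im z\<bar>"
        using K0 \<open>\<And>z. z \<in> Omega M \<Longrightarrow> _\<close>[OF z] by (intro divide_right_mono) auto
      also have "\<dots> = 2 * pi * C + B / K \<bar>Im z\<bar>"
        using K0 by (simp add: field_simps)
      also have "\<dots> \<le> 2 * pi * C + B / K 0"
        using K0 B0 by (intro add_left_mono divide_left_mono) auto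
      finally show ?thesis .
    qed
    then show ?thesis by (intro bdd_aboveI2)
  qed
  ultimately have "\<exists>F. F analytic_on Omega M \<and> (\<forall>z. Re z > 0 \<longrightarrow> F z = laplace_transform f z) \<and>
      bdd_above ((\<lambda>z. norm (z * F z) / K \<bar>Im z\<bar>) ` Omega M)"
    by blast
  moreover have "uniformly_continuous_on {0..} f'"
    unfolding f'_def by (rule uniformly_continuous_on_fourier_integral[OF wg])
  ultimately have "admissible M K f"
    unfolding admissible_def using bdd lip der[of _ "{0..}"] by blast
  then show ?thesis unfolding f_def g_def .
qed

section \<open>The test kernel and its estimates\<close>

text \<open>For \<open>\<bar>Re z\<bar> \<le> A\<close> the double exponential suppresses \<open>Im z \<le> s\<close>, faster than the growth
  \<open>exp (A * y)\<close> admitted below, and is harmless for \<open>Im z\<close> beyond a multiple of \<open>s\<close>; hence the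
  Fourier integral along the imaginary axis has frequencies of order \<open>s\<close> and peaks at \<open>t = y\<close>
  with height of order \<open>1 / s\<close>.\<close>

definition test_kernel :: "real \<Rightarrow> real \<Rightarrow> real \<Rightarrow> real \<Rightarrow> complex \<Rightarrow> complex" where
  "test_kernel A \<beta> s y z =
     of_real (s^2) * exp (- exp (of_real (\<beta> * s + s / A) + \<i> * z / of_real A)) * exp (- z * of_real y)
       / (of_real (4 * A^2) - z^2)^2"

text \<open>The zeros \<open>2 * A\<close> and \<open>- 2 * A\<close> lie outside the strip with a
  margin: \<open>4 * A^2 - (Re z)^2\<close> is at least \<open>3 * A^2\<close>. Squared in
  \<open>test_kernel\<close>, the denominator gives decay of order four.\<close>

lemma Re_denominator_ge:
  assumes "A \<ge> 1" "\<bar>Re z\<bar> \<le> A"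
  shows "1 + (Im z)^2 \<le> Re (of_real (4 * A^2) - z^2)"
proof -
  have "(Re z)^2 \<le> A^2"
    using assms by (simp add: abs_le_square_iff[symmetric])
  moreover have "1 \<le> A^2" using assms by simp
  ultimately have "1 + (Im z)^2 \<le> 4 * A^2 - ((Re z)^2 - (Im z)^2)" by simp
  then show ?thesis by (simp add: Re_power2)
qed

lemma norm_denominator_ge:
  assumes "A \<ge> 1" "\<bar>Re z\<bar> \<le> A"
  shows "1 + (Im z)^2 \<le> norm (of_real (4 * A^2) - z^2)"
  by (rule order_trans[OF Re_denominator_ge[OF assms] complex_Re_le_cmod])

lemma holomorphic_on_test_kernel:
  assumes "A \<ge> 1" "\<And>z. z \<in> S \<Longrightarrow> \<bar>Re z\<bar> \<le> A"
  shows "test_kernel A \<beta> s y holomorphic_on S"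
proof -
  have "of_real (4 * A^2) - z^2 \<noteq> 0" if "z \<in> S" for z
  proof -
    have "1 + (Im z)^2 \<le> norm (of_real (4 * A^2) - z^2)"
      by (rule norm_denominator_ge) (use assms that in auto)
    moreover have "0 < 1 + (Im z)^2"
      by (simp add: add_pos_nonneg)
    ultimately have "0 < norm (of_real (4 * A^2) - z^2)" by linarith
    then show ?thesis unfolding zero_less_norm_iff .
  qed
  then show ?thesis
    unfolding test_kernel_def[abs_def] using assms(1) by (intro holomorphic_intros) auto
qed

lemma norm_double_exp:
  assumes "A \<ge> 1"
  shows "norm (exp (- exp (of_real (\<beta> * s + s / A) + \<i> * z / of_real A)) * exp (- z * of_real y))
    = exp (- (exp (\<beta> * s + (s - Im z) / A) * cos (Re z / A)) - Re z * y)"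
proof -
  have "Re (of_real (\<beta> * s + s / A) + \<i> * z / of_real A) = \<beta> * s + (s - Im z) / A"
    "Im (of_real (\<beta> * s + s / A) + \<i> * z / of_real A) = Re z / A"
    using assms by (simp_all add: diff_divide_distrib)
  then show ?thesis
    unfolding norm_mult norm_exp_eq_Re uminus_complex.sel Re_exp
    by (simp flip: exp_add)
qed

text \<open>Explains the division by \<open>A\<close> in \<open>test_kernel\<close>: for
  \<open>\<bar>Re z\<bar> \<le> A\<close> the cosine in \<open>norm_double_exp\<close> has an
  argument of modulus at most \<open>1 < pi / 2\<close>, so the double exponential damps throughout
  the strip.\<close>

lemma cos_ge_cos_one:
  assumes "\<bar>x\<bar> \<le> (1::real)"
  shows "cos 1 \<le> cos x" "cos (1::real) > 0"
proof -
  have "cos 1 \<le> cos \<bar>x\<bar>"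
    using assms pi_gt3 by (subst cos_mono_le_eq) auto
  then show "cos 1 \<le> cos x" by (simp add: abs_if split: if_splits)
  show "cos (1::real) > 0"
    using pi_gt3 by (intro cos_gt_zero_pi) auto
qed

text \<open>\<open>Q\<close> has to control \<open>exp (- z * y)\<close> only at heights at least
  \<open>s\<close>. Below, the double exponential beats the crude bound \<open>exp (A * y)\<close>,
  and by \<open>small\<close> a factor \<open>s^4\<close> is left over, which turns
  \<open>(1 + w^2)^2\<close> into \<open>(s^2 + w^2)^2\<close>.\<close>

lemma norm_test_kernel_le:
  assumes A: "A \<ge> 1" and s: "s \<ge> 1" and y: "y \<ge> 0"
    and small: "s^4 * exp (A * y - cos 1 * exp (\<beta> * s)) \<le> 1"
    and z: "\<bar>Re z\<bar> \<le> A" and Q: "Q \<ge> 1" "Im z \<ge> s \<Longrightarrow> exp (- Re z * y) \<le> Q"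
  shows "norm (test_kernel A \<beta> s y z) \<le> 4 * Q * (s^2 / (s^2 + (Im z)^2)^2)"
proof -
  define w where "w = Im z"
  define E where "E = exp (- (exp (\<beta> * s + (s - w) / A) * cos (Re z / A)) - Re z * y)"
  define D where "D = norm (of_real (4 * A^2) - z^2)"
  have D: "1 + w^2 \<le> D"
    unfolding D_def w_def by (rule norm_denominator_ge[OF A z])
  have pos: "0 < 1 + w^2" by (simp add: add_pos_nonneg)
  have "\<bar>Re z / A\<bar> \<le> 1" using A z by simp
  note cos1 = cos_ge_cos_one[OF this]
  have E: "E * (s^2 + w^2)^2 \<le> 4 * Q * (1 + w^2)^2"
  proof (cases "w \<le> s")
    case True
    \<comment> \<open>For \<open>w \<le> s\<close> the term \<open>(s - w) / A\<close> only enlarges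
      the inner exponential beyond \<open>exp (\<beta> * s)\<close>.\<close>
    have "cos 1 * exp (\<beta> * s) \<le> exp (\<beta> * s + (s - w) / A) * cos (Re z / A)"
      using cos1 True A by (subst mult.commute, intro mult_mono) auto
    moreover have "- Re z * y \<le> A * y"
      using z y by (intro mult_right_mono) auto
    ultimately have "E \<le> exp (A * y - cos 1 * exp (\<beta> * s))"
      by (simp add: E_def)
    then have "s^4 * E \<le> s^4 * exp (A * y - cos 1 * exp (\<beta> * s))"
      by (intro mult_left_mono) auto
    then have sE: "s^4 * E \<le> 1" using small by simp
    have "1 * w^2 \<le> s^2 * w^2" using s by (intro mult_right_mono) auto
    then have "s^2 + w^2 \<le> s^2 * (1 + w^2)" by (simp add: algebra_simps)
    then have "E * (s^2 + w^2)^2 \<le> E * (s^2 * (1 + w^2))^2"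
      by (intro mult_left_mono power_mono) (auto simp: E_def)
    also have "\<dots> = (s^4 * E) * (1 + w^2)^2"
      by (simp add: power_mult_distrib)
    also have "\<dots> \<le> (4 * Q) * (1 + w^2)^2"
      using sE Q(1) by (intro mult_right_mono) auto
    finally show ?thesis .
  next
    case False
    have "0 \<le> exp (\<beta> * s + (s - w) / A) * cos (Re z / A)"
      using cos1 by (intro mult_nonneg_nonneg) auto
    then have "E \<le> exp (- Re z * y)"
      by (simp add: E_def)
    also have "\<dots> \<le> Q" using Q(2) False by (simp add: w_def)
    finally have EQ: "E \<le> Q" .
    \<comment> \<open>For \<open>w > s\<close> the quantities \<open>s^2 + w^2\<close> and
      \<open>1 + w^2\<close> are comparable, so no help from the double exponential is
      needed.\<close>
    have "s^2 \<le> w^2" using False s by (intro power_mono) auto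
    then have "s^2 + w^2 \<le> 2 * (1 + w^2)" by simp
    then have "E * (s^2 + w^2)^2 \<le> Q * (2 * (1 + w^2))^2"
      using EQ Q(1) by (intro mult_mono power_mono) auto
    also have "\<dots> = 4 * Q * (1 + w^2)^2"
      by (simp only: power_mult_distrib) simp
    finally show ?thesis .
  qed
  have "s^2 + w^2 > 0" using s by (intro add_pos_nonneg) auto
  then have "E \<le> 4 * Q * (1 + w^2)^2 / (s^2 + w^2)^2"
    using E by (simp add: pos_le_divide_eq[OF zero_less_power])
  then have "s^2 * E / D^2 \<le> s^2 * (4 * Q * (1 + w^2)^2 / (s^2 + w^2)^2) / (1 + w^2)^2"
    using D pos Q(1) by (intro frac_le mult_left_mono power_mono mult_nonneg_nonneg divide_nonneg_nonneg) auto
  also have "\<dots> = 4 * Q * (s^2 / (s^2 + w^2)^2)"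
    using pos by simp
  also have "s^2 * E / D^2 = norm (test_kernel A \<beta> s y z)"
    unfolding test_kernel_def mult.assoc norm_divide norm_mult[of "of_real (s^2)"]
      norm_double_exp[OF A] norm_power D_def E_def w_def norm_of_real by simp
  finally show ?thesis unfolding w_def .
qed

text \<open>The first bound integrates to order \<open>1 / s\<close>, the size of the test function.
  The second carries the weight needed for derivatives and Cauchy transforms, and its majorant is a
  multiple of the Poisson kernel, whose mass is independent of \<open>s\<close>.\<close>

lemma weighted_norm_test_kernel_le:
  assumes "A \<ge> 1" and s: "s \<ge> 1" and "y \<ge> 0"
    and "s^4 * exp (A * y - cos 1 * exp (\<beta> * s)) \<le> 1"
    and "\<bar>Re z\<bar> \<le> A" and "Q \<ge> 1" "Im z \<ge> s \<Longrightarrow> exp (- Re z * y) \<le> Q"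
  shows "norm (test_kernel A \<beta> s y z) \<le> 4 * Q / (s^2 + (Im z)^2)"
    and "(1 + \<bar>Im z\<bar>) * norm (test_kernel A \<beta> s y z) \<le> 8 * Q * (s / (s^2 + (Im z)^2))"
proof -
  define w where "w = Im z"
  have pos: "s^2 + w^2 > 0" using s by (intro add_pos_nonneg) auto
  note le = norm_test_kernel_le[OF assms, folded w_def]
  have "s^2 / (s^2 + w^2)^2 \<le> (s^2 + w^2) / (s^2 + w^2)^2"
    by (intro divide_right_mono) auto
  also have "\<dots> = 1 / (s^2 + w^2)"
    using pos by (simp add: power2_eq_square)
  finally have "4 * Q * (s^2 / (s^2 + w^2)^2) \<le> 4 * Q * (1 / (s^2 + w^2))"
    using assms(6) by (intro mult_left_mono) auto
  with le show "norm (test_kernel A \<beta> s y z) \<le> 4 * Q / (s^2 + (Im z)^2)"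
    by (simp add: w_def)
  have "(1 + \<bar>w\<bar>) * s \<le> 2 * (s^2 + w^2)"
  proof -
    have 1: "s \<le> s * s" using mult_left_mono[of 1 s s] s by simp
    define v where "v = \<bar>w\<bar>"
    have "0 \<le> (v - s)^2" by simp
    then have 2: "2 * (s * v) \<le> s * s + v * v"
      by (simp add: power2_eq_square algebra_simps)
    have eqs: "(1 + v) * s = s + s * v" "s^2 + w^2 = s * s + v * v" and "0 \<le> v * v"
      by (simp_all add: v_def power2_eq_square algebra_simps)
    have "s + p \<le> 2 * (q + r)" if "s \<le> q" "2 * p \<le> q + r" "0 \<le> r" for p q r
      using that s by (smt (verit))
    from this[OF 1 2 \<open>0 \<le> v * v\<close>] show ?thesis
      unfolding v_def[symmetric] eqs .
  qed
  then have "((1 + \<bar>w\<bar>) * s) * (s / (s^2 + w^2)^2) \<le> (2 * (s^2 + w^2)) * (s / (s^2 + w^2)^2)"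
    using s by (intro mult_right_mono) auto
  also have "\<dots> = 2 * (s / (s^2 + w^2))"
    using pos by (simp add: power2_eq_square[of "s^2 + w^2"] del: distrib_left_numeral)
  finally have *: "(1 + \<bar>w\<bar>) * (s^2 / (s^2 + w^2)^2) \<le> 2 * (s / (s^2 + w^2))"
    by (simp add: power2_eq_square mult_ac)
  have "(1 + \<bar>w\<bar>) * norm (test_kernel A \<beta> s y z) \<le> (1 + \<bar>w\<bar>) * (4 * Q * (s^2 / (s^2 + w^2)^2))"
    by (intro mult_left_mono le) auto
  also have "\<dots> = 4 * Q * ((1 + \<bar>w\<bar>) * (s^2 / (s^2 + w^2)^2))"
    by (simp add: mult_ac)
  also have "\<dots> \<le> 4 * Q * (2 * (s / (s^2 + w^2)))"
    using assms(6) by (intro mult_left_mono[OF *]) auto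
  finally show "(1 + \<bar>Im z\<bar>) * norm (test_kernel A \<beta> s y z) \<le> 8 * Q * (s / (s^2 + (Im z)^2))"
    by (simp add: w_def)
qed

text \<open>The two logarithms in \<open>M_K\<close> are used here: for
  \<open>w = Im z \<ge> s\<close> the exponential is at most
  \<open>exp (M s * L / M w) \<le> exp L = (1 + s) * (1 + K s)\<close>. The first factor, times
  \<open>s\<close>, is absorbed by \<open>s^2 + w^2\<close>; the second is at most a multiple of
  \<open>K w\<close>, because \<open>K\<close> is bounded below by \<open>K 0\<close>.\<close>

lemma norm_test_kernel_le_Omega:
  assumes M: "\<And>s. s \<ge> 0 \<Longrightarrow> M s > 0" "mono_on {0..} M"
    and K: "\<And>s. s \<ge> 0 \<Longrightarrow> K s > 0" "mono_on {0..} K"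
    and A: "A \<ge> 1" "A \<ge> 1 / M 0" and s: "s \<ge> 1"
    and small: "s^4 * exp (A * M_K M K s - cos 1 * exp (\<beta> * s)) \<le> 1"
    and z: "z \<in> Omega M" "Re z \<le> A"
  shows "(1 + norm z) * norm (test_kernel A \<beta> s (M_K M K s) z) \<le> 16 * (A + 1) * (1 + 1 / K 0) * K \<bar>Im z\<bar>"
proof -
  define w where "w = \<bar>Im z\<bar>"
  define L where "L = ln (1 + s) + ln (1 + K s)"
  \<comment> \<open>\<open>K w\<close> instead of \<open>K s\<close> keeps the final bound in terms
    of the height of \<open>z\<close>; the two are compared by monotonicity when
    \<open>w \<ge> s\<close>.\<close>
  define Q where "Q = (1 + s) * (1 + K w)"
  have Kw: "K w > 0" "K s > 0" "K 0 \<le> K w" "K 0 > 0"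
    using K s by (auto intro: mono_onD simp: w_def)
  have Mw: "M w > 0" "M 0 \<le> M w" "M 0 > 0" "M s > 0"
    using M s by (auto intro: mono_onD simp: w_def)
  have L: "L \<ge> 0" using s Kw by (simp add: L_def)
  have y: "M_K M K s = M s * L" by (simp add: M_K_def L_def)
  have y0: "M_K M K s \<ge> 0" unfolding y using L Mw by simp
  have Q1: "Q \<ge> 1"
    unfolding Q_def using s Kw by (simp add: algebra_simps)
  have Rez: "- Re z < 1 / M w" using z by (simp add: Omega_def w_def)
  have "1 / M w \<le> 1 / M 0" using Mw by (intro divide_left_mono) auto
  then have reA: "\<bar>Re z\<bar> \<le> A" using Rez z A by linarith
  have Q2: "exp (- Re z * M_K M K s) \<le> Q" if "Im z \<ge> s"
  proof -
    have w: "s \<le> w" "w = Im z" using that s by (auto simp: w_def)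
    have "M s \<le> M w" "K s \<le> K w" using M K w s by (auto intro: mono_onD)
    have "- Re z * M_K M K s \<le> 1 / M w * (M s * L)"
      unfolding y[symmetric] using Rez y0 by (intro mult_right_mono) auto
    also have "\<dots> \<le> 1 / M w * (M w * L)"
      using \<open>M s \<le> M w\<close> L Mw by (intro mult_left_mono mult_right_mono) auto
    also have "\<dots> = L" using Mw by simp
    finally have "exp (- Re z * M_K M K s) \<le> exp L" by simp
    also have "exp L = (1 + s) * (1 + K s)"
      using s Kw by (simp add: L_def exp_add)
    also have "\<dots> \<le> Q"
      unfolding Q_def using s Kw \<open>K s \<le> K w\<close> by (intro mult_left_mono) auto
    finally show ?thesis .
  qed
  have "1 + norm z \<le> 1 + (A + w)"
    using cmod_le[of z] reA by (simp add: w_def)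
  also have "\<dots> \<le> (A + 1) * (1 + w)"
    using A by (simp add: algebra_simps w_def)
  finally have nz: "1 + norm z \<le> (A + 1) * (1 + w)" .
  have "(1 + norm z) * norm (test_kernel A \<beta> s (M_K M K s) z)
      \<le> (A + 1) * (1 + w) * norm (test_kernel A \<beta> s (M_K M K s) z)"
    by (intro mult_right_mono nz) auto
  also have "\<dots> = (A + 1) * ((1 + w) * norm (test_kernel A \<beta> s (M_K M K s) z))"
    by simp
  also have "\<dots> \<le> (A + 1) * (8 * Q * (s / (s^2 + (Im z)^2)))"
    using weighted_norm_test_kernel_le(2)[OF A(1) s y0 small reA Q1 Q2] A
    by (intro mult_left_mono) (auto simp: w_def)
  also have "\<dots> = 8 * (A + 1) * (1 + K w) * (((1 + s) * s) / (s^2 + (Im z)^2))"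
    by (simp add: Q_def)
  also have "\<dots> \<le> 8 * (A + 1) * (1 + K w) * 2"
  proof (intro mult_left_mono)
    have "(1 + s) * s \<le> 2 * s^2" using s by (simp add: algebra_simps power2_eq_square)
    then have "(1 + s) * s \<le> 2 * (s^2 + (Im z)^2)" by (simp add: add_increasing2)
    moreover have "s^2 + (Im z)^2 > 0" using s by (intro add_pos_nonneg) auto
    ultimately show "((1 + s) * s) / (s^2 + (Im z)^2) \<le> 2"
      by (simp add: pos_divide_le_eq)
  qed (use A Kw in auto)
  also have "\<dots> = 16 * (A + 1) * (1 + K w)" by simp
  also have "\<dots> \<le> 16 * (A + 1) * ((1 + 1 / K 0) * K w)"
    using A Kw by (intro mult_left_mono) (auto simp: field_simps)
  finally show ?thesis by (simp add: w_def mult.assoc)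
qed

text \<open>At \<open>t = y\<close> the factor \<open>cis (w * y)\<close> cancels the exponential of
  the kernel on the imaginary axis. What remains is the nonnegative function \<open>\<phi>\<close>,
  so one interval of length of order \<open>s\<close> already gives the lower bound.\<close>

lemma fourier_integral_test_kernel_ge:
  assumes A: "A \<ge> 1" and \<beta>: "\<beta> \<ge> 0" and s: "s \<ge> 1"
    and int: "integrable lborel (\<lambda>w. test_kernel A \<beta> s y (Complex 0 w))"
  defines "B \<equiv> 1 + A * \<beta>"
  shows "B * exp (-1) / (4 * A^2 + 4 * B^2)^2 / s
    \<le> norm (\<integral>w. test_kernel A \<beta> s y (Complex 0 w) * cis (w * y) \<partial>lborel)"
proof -
  define \<phi> where "\<phi> w = s^2 * exp (- exp (\<beta> * s + (s - w) / A)) / (4 * A^2 + w^2)^2" for w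
  have eq: "test_kernel A \<beta> s y (Complex 0 w) * cis (w * y) = of_real (\<phi> w)" for w
  proof -
    have 1: "\<i> * Complex 0 w = of_real (- w)" "(Complex 0 w)^2 = of_real (- (w^2))"
      by (simp_all add: complex_eq_iff power2_eq_square)
    have "- Complex 0 w * of_real y + \<i> * of_real (w * y) = 0"
      by (simp add: complex_eq_iff)
    then have 2: "exp (- Complex 0 w * of_real y) * cis (w * y) = 1"
      unfolding cis_conv_exp exp_add[symmetric] by (simp only: exp_zero)
    have 3: "of_real (\<beta> * s + s / A) + \<i> * Complex 0 w / of_real A = (of_real (\<beta> * s + (s - w) / A) :: complex)"
      unfolding 1 by (simp add: diff_divide_distrib)
    then have "test_kernel A \<beta> s y (Complex 0 w) * cis (w * y)
      = of_real (s^2) * exp (- exp (of_real (\<beta> * s + (s - w) / A))) / (of_real (4 * A^2) - of_real (- (w^2)))^2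
        * (exp (- Complex 0 w * of_real y) * cis (w * y))"
      unfolding test_kernel_def 1(2) 3 by simp
    then show ?thesis
      unfolding 2 by (simp add: \<phi>_def exp_of_real flip: of_real_minus of_real_diff of_real_power of_real_mult of_real_add)
  qed
  have B: "B \<ge> 1" using A \<beta> by (simp add: B_def)
  have "integrable lborel (\<lambda>w. complex_of_real (\<phi> w))"
    using integrable_mult_cis[OF int, of y] by (simp add: eq)
  then have \<phi>: "integrable lborel \<phi>"
    by (simp add: complex_of_real_integrable_eq)
  \<comment> \<open>A lower bound of \<open>\<phi>\<close> on \<open>[B * s, 2 * B * s]\<close>:
    there \<open>B = 1 + A * \<beta>\<close> makes the inner exponent nonpositive, so the double
    exponential is at least \<open>exp (-1)\<close>, and the denominator is at most
    \<open>((4 * A^2 + 4 * B^2) * s^2)^2\<close>.\<close>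
  define \<kappa> where "\<kappa> = exp (-1) / ((4 * A^2 + 4 * B^2)^2 * s^2)"
  have "B * s * \<kappa> = (\<integral>w. indicator {B * s..2 * B * s} w *\<^sub>R \<kappa> \<partial>lborel)"
    using B s by simp
  also have "\<dots> \<le> (\<integral>w. \<phi> w \<partial>lborel)"
  proof (rule integral_mono)
    show "integrable lborel (\<lambda>w. indicator {B * s..2 * B * s} w *\<^sub>R \<kappa>)"
      by (intro integrable_scaleR_left integrable_real_indicator) (auto simp: emeasure_lborel_Icc_eq)
    fix w
    have "\<kappa> \<le> \<phi> w" if w: "w \<in> {B * s..2 * B * s}"
    proof -
      have "s + A * (\<beta> * s) \<le> w" using w by (simp add: B_def algebra_simps)
      then have "\<beta> * s + (s - w) / A \<le> 0" using A by (simp add: field_simps)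
      then have 1: "exp (-1) \<le> exp (- exp (\<beta> * s + (s - w) / A))" by simp
      have "w^2 \<le> (2 * B * s)^2" using w B s by (intro power_mono) (auto intro: order_trans[rotated])
      moreover have "4 * A^2 * 1 \<le> 4 * A^2 * s^2" using s by (intro mult_left_mono) auto
      ultimately have "4 * A^2 + w^2 \<le> (4 * A^2 + 4 * B^2) * s^2"
        by (simp add: algebra_simps power_mult_distrib)
      then have 2: "(4 * A^2 + w^2)^2 \<le> ((4 * A^2 + 4 * B^2) * s^2)^2"
        by (intro power_mono) auto
      have "0 < 4 * A^2 + w^2" using A by (intro add_pos_nonneg) auto
      then have "s^2 * exp (-1) / ((4 * A^2 + 4 * B^2) * s^2)^2 \<le> \<phi> w"
        unfolding \<phi>_def using 1 2 by (intro frac_le mult_left_mono) auto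
      also have "s^2 * exp (-1) / ((4 * A^2 + 4 * B^2) * s^2)^2 = \<kappa>"
        using s by (simp add: \<kappa>_def power_mult_distrib power2_eq_square)
      finally show ?thesis .
    qed
    moreover have "0 \<le> \<phi> w" by (simp add: \<phi>_def)
    ultimately show "indicator {B * s..2 * B * s} w *\<^sub>R \<kappa> \<le> \<phi> w"
      by (simp add: indicator_def)
  qed (rule \<phi>)
  also have "\<dots> \<le> norm (\<integral>w. complex_of_real (\<phi> w) \<partial>lborel)"
    by simp
  also have "B * s * \<kappa> = B * exp (-1) / (4 * A^2 + 4 * B^2)^2 / s"
    using s by (simp add: \<kappa>_def power2_eq_square)
  finally show ?thesis by (simp add: eq)
qed

section \<open>Series of test functions with geometric weights\<close>

lemma
  fixes a :: "nat \<Rightarrow> 'a::banach"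
  assumes "\<And>n. norm (a n) \<le> (1/2)^n * B"
  shows summable_geometric_bound: "summable a"
    and summable_norm_geometric_bound: "summable (\<lambda>n. norm (a n))"
    and norm_suminf_geometric_bound: "norm (suminf a) \<le> 2 * B"
proof -
  have sums: "(\<lambda>n. (1/2)^n * B) sums (2 * B)"
    using sums_mult2[OF geometric_sums[of "1/2::real"], of B] by simp
  then show 1: "summable (\<lambda>n. norm (a n))"
    using assms by (intro summable_comparison_test[OF _ sums_summable[OF sums]]) auto
  then show "summable a"
    by (rule summable_norm_cancel)
  have "norm (suminf a) \<le> (\<Sum>n. norm (a n))"
    by (rule summable_norm[OF 1])
  also have "\<dots> \<le> (\<Sum>n. (1/2)^n * B)"
    by (rule suminf_le[OF assms 1 sums_summable[OF sums]])
  also have "\<dots> = 2 * B" using sums by (simp add: sums_iff)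
  finally show "norm (suminf a) \<le> 2 * B" .
qed

text \<open>On the imaginary axis \<open>exp (- z * y)\<close> has modulus \<open>1\<close>, so
  \<open>Q = 1\<close> is allowed; \<open>4 / (s^2 + w^2)\<close> is \<open>4 / s\<close> times a
  Poisson kernel of mass \<open>pi\<close>.\<close>

lemma
  assumes A: "A \<ge> 1" and s: "s \<ge> 1" and y: "y \<ge> 0"
    and small: "s^4 * exp (A * y - cos 1 * exp (\<beta> * s)) \<le> 1"
  shows integrable_test_kernel_line: "integrable lborel (\<lambda>w. test_kernel A \<beta> s y (Complex 0 w))"
    and norm_fourier_integral_test_kernel_le:
      "norm (\<integral>w. test_kernel A \<beta> s y (Complex 0 w) * cis (w * t) \<partial>lborel) \<le> 4 * pi / s"
proof -
  have le: "norm (test_kernel A \<beta> s y (Complex 0 w)) \<le> 4 / (s^2 + w^2)" for w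
    using weighted_norm_test_kernel_le(1)[OF A s y small, of "Complex 0 w" 1] A by simp
  have int: "integrable lborel (\<lambda>w. 4 / s * (s / (s^2 + w^2)))"
    using s by (intro integrable_mult_right integrable_poisson_kernel) auto
  show I: "integrable lborel (\<lambda>w. test_kernel A \<beta> s y (Complex 0 w))"
  proof (rule Bochner_Integration.integrable_bound[OF int])
    have "continuous_on UNIV (\<lambda>w. test_kernel A \<beta> s y (Complex 0 w))"
    proof (rule continuous_on_compose2[where f = "Complex 0"])
      show "continuous_on {z. Re z = 0} (test_kernel A \<beta> s y)"
        using A by (intro holomorphic_on_imp_continuous_on holomorphic_on_test_kernel) auto
      have "Complex 0 = (\<lambda>w. \<i> * of_real w)"
        by (auto simp: complex_eq_iff)
      then show "continuous_on UNIV (Complex 0)"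
        by (auto intro!: continuous_intros)
    qed auto
    then show "(\<lambda>w. test_kernel A \<beta> s y (Complex 0 w)) \<in> borel_measurable lborel"
      by (simp add: borel_measurable_continuous_onI)
    show "AE w in lborel. norm (test_kernel A \<beta> s y (Complex 0 w)) \<le> norm (4 / s * (s / (s^2 + w^2)))"
      using le s by (intro AE_I2) simp
  qed
  have "norm (\<integral>w. test_kernel A \<beta> s y (Complex 0 w) * cis (w * t) \<partial>lborel)
      \<le> (\<integral>w. norm (test_kernel A \<beta> s y (Complex 0 w)) \<partial>lborel)"
    by (rule norm_fourier_integral_le[OF I])
  also have "\<dots> \<le> (\<integral>w. 4 / s * (s / (s^2 + w^2)) \<partial>lborel)"
    using I int le s by (intro integral_mono) auto
  also have "\<dots> = 4 / s * pi"
    using s integral_poisson_kernel[of s] by (simp del: times_divide_eq_right times_divide_eq_left)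
  finally show "norm (\<integral>w. test_kernel A \<beta> s y (Complex 0 w) * cis (w * t) \<partial>lborel) \<le> 4 * pi / s"
    by simp
qed

text \<open>The kernels are summed before integrating. Their bounds, and the masses of their
  majorants, do not depend on \<open>n\<close>, so with the weights \<open>q n\<close> the sum
  \<open>G\<close> meets the conditions of \<open>admissible_fourier_integral\<close>; afterwards
  sum and integral are interchanged.\<close>

lemma admissible_suminf_test_kernel:
  fixes s q :: "nat \<Rightarrow> real"
  assumes M: "\<And>s. s \<ge> 0 \<Longrightarrow> M s > 0" "mono_on {0..} M" "continuous_on {0..} M"
    and K: "\<And>s. s \<ge> 0 \<Longrightarrow> K s > 0" "mono_on {0..} K"
    and A: "A \<ge> 1" "A \<ge> 1 / M 0"
    and s: "\<And>n. s n \<ge> 1" and q: "\<And>n. \<bar>q n\<bar> \<le> (1/2)^n"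
    and small: "\<And>n. s n^4 * exp (A * M_K M K (s n) - cos 1 * exp (\<beta> * s n)) \<le> 1"
  shows "admissible M K (\<lambda>t. \<Sum>n. of_real (q n) *
    (\<integral>w. test_kernel A \<beta> (s n) (M_K M K (s n)) (Complex 0 w) * cis (w * t) \<partial>lborel))"
proof -
  define y where "y n = M_K M K (s n)" for n
  have y0: "y n \<ge> 0" for n
    using M(1)[of "s n"] K(1)[of "s n"] s[of n] by (auto simp: y_def M_K_def)
  define g where "g n z = of_real (q n) * test_kernel A \<beta> (s n) (y n) z" for n z
  define G where "G z = (\<Sum>n. g n z)" for z
  define C where "C = 16 * (A + 1) * (1 + 1 / K 0)"
  have C0: "C \<ge> 0" using A K(1)[of 0] by (simp add: C_def)
  \<comment> \<open>The weight \<open>X\<close> is later \<open>1\<close>, \<open>1 + norm z\<close>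
    or \<open>1 + \<bar>Im z\<bar>\<close>.\<close>
  have g_le: "X * norm (g n z) \<le> (1/2)^n * B"
    if "X * norm (test_kernel A \<beta> (s n) (y n) z) \<le> B" "X \<ge> 0" for X B n z
  proof -
    have "X * norm (g n z) = \<bar>q n\<bar> * (X * norm (test_kernel A \<beta> (s n) (y n) z))"
      by (simp add: g_def norm_mult)
    also have "\<dots> \<le> (1/2)^n * B"
      using that by (intro mult_mono q) auto
    finally show ?thesis .
  qed
  have gK: "(1 + norm z) * norm (g n z) \<le> (1/2)^n * (C * K \<bar>Im z\<bar>)" if "z \<in> Omega M" "Re z \<le> A" for n z
    using norm_test_kernel_le_Omega[OF M(1,2) K A s small that, folded y_def]
    by (intro g_le) (auto simp: C_def)
  have gK': "norm (g n z) \<le> (1/2)^n * (C * K \<bar>Im z\<bar>)" if "z \<in> Omega M" "Re z \<le> A" for n z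
  proof -
    have "1 * norm (g n z) \<le> (1 + norm z) * norm (g n z)"
      by (intro mult_right_mono) auto
    then show ?thesis using gK[OF that, of n] by simp
  qed
  have gh: "(1 + \<bar>Im z\<bar>) * norm (g n z) \<le> (1/2)^n * (8 * (s n / (s n^2 + (Im z)^2)))"
    and gquad: "norm (g n z) \<le> (1/2)^n * (4 / (1 + (Im z)^2))"
    if z: "0 \<le> Re z" "Re z \<le> A" for n z
  proof -
    \<comment> \<open>To the right of the imaginary axis the exponential is at most
      \<open>1\<close>, hence \<open>Q = 1\<close>.\<close>
    have e: "exp (- Re z * y n) \<le> 1"
      using z y0[of n] by simp
    have reA: "\<bar>Re z\<bar> \<le> A" using z by simp
    note le = weighted_norm_test_kernel_le[OF A(1) s y0 small[folded y_def] reA order_refl e]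
    show "(1 + \<bar>Im z\<bar>) * norm (g n z) \<le> (1/2)^n * (8 * (s n / (s n^2 + (Im z)^2)))"
      using le(2) by (intro g_le) auto
    have "4 / (s n^2 + (Im z)^2) \<le> 4 / (1 + (Im z)^2)"
      using s[of n] by (intro divide_left_mono mult_pos_pos add_pos_nonneg) auto
    then show "norm (g n z) \<le> (1/2)^n * (4 / (1 + (Im z)^2))"
      using g_le[of 1 n z "4 / (1 + (Im z)^2)"] order_trans[OF le(1)] by simp
  qed
  define U where "U = Omega M \<inter> {z. Re z < A}"
  have "open U"
    unfolding U_def by (intro open_Int open_Omega[OF M(1,3)] open_halfspace_Re_lt)
  \<comment> \<open>\<open>A \<ge> 1 / M 0\<close> puts this part of \<open>Omega M\<close> into the
    strip where the kernels have no poles.\<close>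
  have absRe: "\<bar>Re z\<bar> \<le> A" if "z \<in> U" for z
  proof -
    have "M 0 \<le> M \<bar>Im z\<bar>" "M 0 > 0" "M \<bar>Im z\<bar> > 0"
      using M by (auto intro: mono_onD)
    then have "1 / M \<bar>Im z\<bar> \<le> 1 / M 0" by (intro divide_left_mono) auto
    then show ?thesis using that A(2) by (auto simp: U_def Omega_def)
  qed
  have hol: "G holomorphic_on U"
  proof (rule holomorphic_uniform_sequence[OF \<open>open U\<close>])
    show "(\<lambda>z. \<Sum>n<N. g n z) holomorphic_on U" for N
      unfolding g_def
      by (intro holomorphic_intros holomorphic_on_test_kernel[OF A(1)] absRe)
    fix x assume "x \<in> U"
    then obtain d where d: "d > 0" "cball x d \<subseteq> U"
      using \<open>open U\<close> open_contains_cball by blast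
    \<comment> \<open>On a closed ball heights are bounded, so monotonicity of \<open>K\<close>
      gives a majorant independent of the point.\<close>
    have "uniform_limit (cball x d) (\<lambda>N z. \<Sum>n<N. g n z) (\<lambda>z. \<Sum>n. g n z) sequentially"
    proof (rule Weierstrass_m_test)
      fix n z assume z: "z \<in> cball x d"
      have "\<bar>Im (z - x)\<bar> \<le> norm (z - x)" by (rule abs_Im_le_cmod)
      also have "\<dots> \<le> d" using z by (simp add: dist_norm norm_minus_commute)
      finally have "\<bar>Im z\<bar> \<le> \<bar>Im x\<bar> + d" by simp
      then have "K \<bar>Im z\<bar> \<le> K (\<bar>Im x\<bar> + d)"
        using d by (intro mono_onD[OF K(2)]) auto
      moreover have "norm (g n z) \<le> (1/2)^n * (C * K \<bar>Im z\<bar>)"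
        using z d by (intro gK') (auto simp: U_def)
      ultimately show "norm (g n z) \<le> (1/2)^n * (C * K (\<bar>Im x\<bar> + d))"
        using C0 by (meson mult_left_mono order_trans zero_le_divide_1_iff zero_le_numeral zero_le_power)
    next
      show "summable (\<lambda>n. (1/2)^n * (C * K (\<bar>Im x\<bar> + d)))"
        by (intro summable_mult2 summable_geometric) auto
    qed
    then show "\<exists>d>0. cball x d \<subseteq> U \<and> uniform_limit (cball x d) (\<lambda>N z. \<Sum>n<N. g n z) G sequentially"
      using d by (auto simp: G_def[abs_def])
  qed
  \<comment> \<open>A weighted sum of Poisson kernels at the scales \<open>s n\<close>; its terms
    have integrals \<open>(1/2)^n * (8 * pi)\<close>, which makes \<open>h\<close> integrable
    however fast \<open>s\<close> grows.\<close>
  define h where "h w = (\<Sum>n. (1/2)^n * (8 * (s n / (s n^2 + w^2))))" for w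
  have s_le: "0 \<le> s n / (s n^2 + w^2)" "s n / (s n^2 + w^2) \<le> 1" for n w
  proof -
    have "s n * 1 \<le> s n * s n" using s[of n] by (intro mult_left_mono) auto
    then have "s n \<le> s n^2 + w^2" by (simp add: power2_eq_square add_increasing2)
    then show "0 \<le> s n / (s n^2 + w^2)" "s n / (s n^2 + w^2) \<le> 1"
      using s[of n] by (auto simp: divide_le_eq)
  qed
  have h_sum: "summable (\<lambda>n. norm ((1/2)^n * (8 * (s n / (s n^2 + w^2)))))" for w
  proof (rule summable_norm_geometric_bound)
    show "norm ((1/2)^n * (8 * (s n / (s n^2 + w^2)))) \<le> (1/2)^n * 8" for n
      using mult_left_mono[OF s_le(2)[of n w], of "(1/2)^n * 8"] s[of n]
      by (simp add: abs_mult mult.assoc)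
  qed
  have h: "integrable lborel h"
    unfolding h_def
  proof (rule integrable_suminf)
    show "integrable lborel (\<lambda>w. (1/2)^n * (8 * (s n / (s n^2 + w^2))))" for n
      using s[of n] by (intro integrable_mult_right integrable_poisson_kernel) auto
    show "AE w in lborel. summable (\<lambda>n. norm ((1/2)^n * (8 * (s n / (s n^2 + w^2)))))"
      using h_sum by simp
    have "(\<integral>w. norm ((1/2)^n * (8 * (s n / (s n^2 + w^2)))) \<partial>lborel) = (1/2)^n * (8 * pi)" for n
    proof -
      have "norm ((1/2)^n * (8 * (s n / (s n^2 + w^2)))) = (1/2)^n * (8 * (s n / (s n^2 + w^2)))" for w
        using s[of n] by (simp add: abs_mult)
      then show ?thesis
        using integral_poisson_kernel[of "s n"] s[of n] by (simp del: times_divide_eq_right times_divide_eq_left)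
    qed
    then show "summable (\<lambda>n. \<integral>w. norm ((1/2)^n * (8 * (s n / (s n^2 + w^2)))) \<partial>lborel)"
      by (simp only:) (intro summable_mult2 summable_geometric, auto)
  qed
  have adm: "admissible M K (\<lambda>t. \<integral>w. G (Complex 0 w) * cis (w * t) \<partial>lborel)"
  \<comment> \<open>\<open>G\<close> is known to be holomorphic only for \<open>Re z < A\<close>, so
    the shifted contour is placed at \<open>A / 2\<close>. The constants double by summing the
    geometric weights.\<close>
  proof (rule admissible_fourier_integral[OF M(1,3) K, where a = "A / 2" and b = A and h = h
        and C = "2 * C" and C' = 8])
    show "G holomorphic_on (Omega M \<inter> {z. Re z < A})"
      using hol by (simp add: U_def)
    fix z
    show "norm z * norm (G z) \<le> 2 * C * K \<bar>Im z\<bar>" if "z \<in> Omega M" "Re z \<le> A / 2"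
    proof -
      have z: "z \<in> Omega M" "Re z \<le> A" using that A by auto
      have "norm (z * g n z) \<le> (1/2)^n * (C * K \<bar>Im z\<bar>)" for n
        using gK[OF z, of n] unfolding norm_mult
        by (rule order_trans[rotated]) (auto intro: mult_right_mono)
      from norm_suminf_geometric_bound[of "\<lambda>n. z * g n z", OF this]
      have "norm (\<Sum>n. z * g n z) \<le> 2 * (C * K \<bar>Im z\<bar>)" .
      then show ?thesis
        using suminf_mult[OF summable_geometric_bound[OF gK'[OF z]], of z]
        by (simp add: G_def norm_mult)
    qed
    assume "0 \<le> Re z" "Re z \<le> A / 2"
    then have z: "0 \<le> Re z" "Re z \<le> A" using A by auto
    show "norm (G z) \<le> 8 / (1 + (Im z)^2)"
      using norm_suminf_geometric_bound[OF gquad[OF z]] by (simp add: G_def)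
    have sg: "summable (\<lambda>n. norm (g n z))"
      by (rule summable_norm_geometric_bound[OF gquad[OF z]])
    have "(1 + \<bar>Im z\<bar>) * norm (G z) \<le> (1 + \<bar>Im z\<bar>) * (\<Sum>n. norm (g n z))"
      unfolding G_def by (intro mult_left_mono summable_norm sg) auto
    also have "\<dots> = (\<Sum>n. (1 + \<bar>Im z\<bar>) * norm (g n z))"
      by (rule suminf_mult[OF sg, symmetric])
    also have "\<dots> \<le> h (Im z)"
      unfolding h_def
      by (intro suminf_le gh[OF z] summable_mult sg summable_norm_cancel[OF h_sum])
    finally show "(1 + \<bar>Im z\<bar>) * norm (G z) \<le> h (Im z)" .
  qed (use A h in auto)
  have int: "integrable lborel (\<lambda>w. g n (Complex 0 w) * cis (w * t))" for n t
    unfolding g_def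
    by (intro integrable_mult_cis integrable_mult_right
        integrable_test_kernel_line[OF A(1) s y0 small[folded y_def]])
  have line: "norm (g n (Complex 0 w) * cis (w * t)) \<le> (1/2)^n * (4 / (1 + w^2))" for n w t
    using gquad[of "Complex 0 w" n] A by (simp add: norm_mult)
  have sumG: "summable (\<lambda>n. g n (Complex 0 w))" for w
    by (rule summable_geometric_bound[OF gquad]) (use A in auto)
  have "(\<integral>w. G (Complex 0 w) * cis (w * t) \<partial>lborel) = (\<Sum>n. of_real (q n) *
    (\<integral>w. test_kernel A \<beta> (s n) (y n) (Complex 0 w) * cis (w * t) \<partial>lborel))" for t
  proof -
    have "(\<integral>w. G (Complex 0 w) * cis (w * t) \<partial>lborel)
      = (\<integral>w. (\<Sum>n. g n (Complex 0 w) * cis (w * t)) \<partial>lborel)"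
      unfolding G_def by (intro Bochner_Integration.integral_cong refl suminf_mult2 sumG)
    also have "\<dots> = (\<Sum>n. \<integral>w. g n (Complex 0 w) * cis (w * t) \<partial>lborel)"
    proof (rule integral_suminf[OF int])
      show "AE w in lborel. summable (\<lambda>n. norm (g n (Complex 0 w) * cis (w * t)))"
        by (intro AE_I2 summable_norm_geometric_bound[OF line])
      have "norm (\<integral>w. norm (g n (Complex 0 w) * cis (w * t)) \<partial>lborel) \<le> (1/2)^n * (4 * pi)" for n
      proof -
        have "(\<integral>w. norm (g n (Complex 0 w) * cis (w * t)) \<partial>lborel)
            \<le> (\<integral>w. (1/2)^n * 4 * (1 / (1^2 + w^2)) \<partial>lborel)"
        proof (rule integral_mono)
          show "integrable lborel (\<lambda>w. (1/2)^n * 4 * (1 / (1^2 + w^2)) :: real)"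
            by (intro integrable_mult_right integrable_poisson_kernel) auto
        qed (use int line in auto)
        also have "\<dots> = (1/2)^n * 4 * pi"
          using integral_poisson_kernel[of 1]
          by (simp del: times_divide_eq_right times_divide_eq_left)
        finally show ?thesis by simp
      qed
      then show "summable (\<lambda>n. \<integral>w. norm (g n (Complex 0 w) * cis (w * t)) \<partial>lborel)"
        by (rule summable_geometric_bound)
    qed
    finally show ?thesis by (simp add: g_def mult.assoc)
  qed
  then show ?thesis using adm by (simp add: y_def)
qed

section \<open>The gliding hump construction\<close>

text \<open>Scales are chosen one after another. At \<open>m (s n)\<close> the partial sum has size
  at least \<open>(1/2)^n * (c / s n) / 2\<close>, and the later scales are so large that all later
  terms together cost at most half of this. Since \<open>r (m (s n))\<close> exceeds
  \<open>4^n * s n\<close>, the product grows like \<open>2^n\<close>.\<close>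

lemma gliding_hump:
  fixes \<phi> :: "real \<Rightarrow> real \<Rightarrow> complex" and m r :: "real \<Rightarrow> real"
  assumes s0: "s0 > 0" and c: "c > 0"
    and up: "\<And>s t. s \<ge> s0 \<Longrightarrow> norm (\<phi> s t) \<le> C / s"
    and low: "\<And>s. s \<ge> s0 \<Longrightarrow> c / s \<le> norm (\<phi> s (m s))"
    and bad: "\<And>D N. \<exists>s\<ge>N. r (m s) > D * s"
  obtains s q :: "nat \<Rightarrow> real" where "\<And>n. s n \<ge> s0" "\<And>n. s n \<ge> real n" "\<And>n. \<bar>q n\<bar> \<le> (1/2)^n"
    "\<And>n. c / 4 * 2^n \<le> r (m (s n)) * norm (\<Sum>k. of_real (q k) * \<phi> (s k) (m (s n)))"
proof -
  \<comment> \<open>A state consists of the scale \<open>s\<close>, its weight \<open>q\<close> and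
    the partial sum \<open>a\<close> up to this term; the clause for \<open>n = 0\<close> anchors
    the recursion for \<open>a\<close>.\<close>
  define P where "P n x \<longleftrightarrow> (case x of (s, q, a) \<Rightarrow> s0 \<le> s \<and> real n \<le> s \<and> 4^n * s < r (m s)
      \<and> \<bar>q\<bar> \<le> (1/2)^n \<and> (1/2)^n * (c / s) / 2 \<le> norm (a (m s))
      \<and> (n = 0 \<longrightarrow> a = (\<lambda>t. of_real q * \<phi> s t)))" for n and x :: "real \<times> real \<times> (real \<Rightarrow> complex)"
  \<comment> \<open>The bound on \<open>C / s'\<close> makes the tail after step \<open>n\<close>
    harmless at \<open>m s\<close>; the monotonicity of the scales extends it from the next term to
    all later ones.\<close>
  define R where "R n x x' \<longleftrightarrow> (case x of (s, q, a) \<Rightarrow> case x' of (s', q', a') \<Rightarrow>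
      s \<le> s' \<and> C / s' \<le> (1/2)^n * (c / s) / 4 \<and> a' = (\<lambda>t. a t + of_real q' * \<phi> s' t))"
    for n :: nat and x x' :: "real \<times> real \<times> (real \<Rightarrow> complex)"
  have C0: "C \<ge> 0"
    using order_trans[OF norm_ge_zero up[of s0]] s0 by (simp add: zero_le_divide_iff)
  have "\<exists>f. \<forall>n. P n (f n) \<and> R n (f n) (f (Suc n))"
  proof (rule dependent_nat_choice)
    obtain s where s: "s \<ge> s0" "r (m s) > 1 * s"
      using bad by blast
    have "0 \<le> c / s" using s(1) s0 c by simp
    moreover have "x / 2 \<le> x" if "0 \<le> x" for x :: real using that by simp
    ultimately have "c / s / 2 \<le> c / s" by blast
    also have "\<dots> \<le> norm (\<phi> s (m s))" by (rule low[OF s(1)])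
    finally have "c / s / 2 \<le> norm (\<phi> s (m s))" .
    then have "P 0 (s, 1, \<phi> s)"
      using s s0 by (simp add: P_def)
    then show "\<exists>x. P 0 x" by blast
  next
    fix x :: "real \<times> real \<times> (real \<Rightarrow> complex)" and n assume "P n x"
    obtain s q a where x: "x = (s, q, a)" by (cases x)
    have s: "s \<ge> s0" "s > 0" using \<open>P n x\<close> s0 by (auto simp: P_def x)
    \<comment> \<open>The last entry is the smallness condition
      \<open>C / s' \<le> (1/2)^n * (c / s) / 4\<close> solved for \<open>s'\<close>.\<close>
    define N where "N = max (max s0 (real (Suc n))) (max s (4 * C * s * 2^n / c))"
    obtain s' where s': "s' \<ge> N" "r (m s') > 4^(Suc n) * s'"
      using bad by blast
    have N: "s' \<ge> s0" "s' \<ge> real (Suc n)" "s' \<ge> s" "s' \<ge> 4 * C * s * 2^n / c"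
      using s'(1) by (auto simp: N_def)
    have small: "C / s' \<le> (1/2)^n * (c / s) / 4"
    proof -
      have "C = 4 * C * s * 2^n / (4 * s * 2^n)" using s by simp
      also have "\<dots> \<le> s' * c / (4 * s * 2^n)"
        using N(4) s c by (intro divide_right_mono) (auto simp: pos_divide_le_eq)
      also have "\<dots> = (1/2)^n * (c / s) / 4 * s'"
        by (simp add: power_one_over mult_ac)
      finally show ?thesis
        using N(1) s0 by (subst pos_divide_le_eq) auto
    qed
    define b where "b = of_real ((1/2)^(Suc n)) * \<phi> s' (m s')"
    have nb: "(1/2)^(Suc n) * (c / s') \<le> norm b"
    proof -
      have "(1/2)^(Suc n) * (c / s') \<le> (1/2)^(Suc n) * norm (\<phi> s' (m s'))"
        by (intro mult_left_mono low N(1)) auto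
      then show ?thesis
        unfolding b_def norm_mult norm_of_real by simp
    qed
    \<comment> \<open>one of the weights \<open>0\<close> and \<open>2\<close> to the \<open>-(n+1)\<close> prevents cancellation at \<open>m s'\<close>\<close>
    obtain q' where q': "\<bar>q'\<bar> \<le> (1/2)^(Suc n)"
      "norm b / 2 \<le> norm (a (m s') + of_real q' * \<phi> s' (m s'))"
    proof (cases "norm b / 2 \<le> norm (a (m s'))")
      case True
      then show ?thesis by (intro that[of 0]) auto
    next
      case False
      have "norm b \<le> norm (a (m s') + b) + norm (a (m s'))" by norm
      then have "norm b / 2 \<le> norm (a (m s') + b)" using False by linarith
      then show ?thesis by (intro that[of "(1/2)^(Suc n)"]) (auto simp: b_def)
    qed
    have "P (Suc n) (s', q', \<lambda>t. a t + of_real q' * \<phi> s' t)"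
      unfolding P_def using N s' q' nb by auto
    moreover have "R n x (s', q', \<lambda>t. a t + of_real q' * \<phi> s' t)"
      unfolding R_def x using N small by auto
    ultimately show "\<exists>x'. P (Suc n) x' \<and> R n x x'" by blast
  qed
  then obtain f where f: "\<And>n. P n (f n)" "\<And>n. R n (f n) (f (Suc n))" by blast
  define s where "s n = fst (f n)" for n
  define q where "q n = fst (snd (f n))" for n
  define a where "a n = snd (snd (f n))" for n
  have fn: "f n = (s n, q n, a n)" for n by (simp add: s_def q_def a_def)
  have P: "s0 \<le> s n" "real n \<le> s n" "4^n * s n < r (m (s n))" "\<bar>q n\<bar> \<le> (1/2)^n"
      "(1/2)^n * (c / s n) / 2 \<le> norm (a n (m (s n)))" for n
    using f(1)[of n] by (auto simp: P_def fn)
  have a0: "a 0 = (\<lambda>t. of_real (q 0) * \<phi> (s 0) t)"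
    using f(1)[of 0] by (auto simp: P_def fn)
  have R: "s n \<le> s (Suc n)" "C / s (Suc n) \<le> (1/2)^n * (c / s n) / 4"
    "a (Suc n) = (\<lambda>t. a n t + of_real (q (Suc n)) * \<phi> (s (Suc n)) t)" for n
    using f(2)[of n] by (auto simp: R_def fn)
  have a: "a n t = (\<Sum>k<Suc n. of_real (q k) * \<phi> (s k) t)" for n t
    by (induction n) (simp_all add: a0 R(3))
  have mono: "s n \<le> s k" if "n \<le> k" for n k
    using lift_Suc_mono_le[of s, OF R(1) that] .
  have spos: "s n > 0" for n using P(1)[of n] s0 by linarith
  have term_le: "norm (of_real (q k) * \<phi> (s k) t) \<le> (1/2)^k * (C / s n)" if "n \<le> k" for k n t
  proof -
    have "norm (\<phi> (s k) t) \<le> C / s k" by (rule up[OF P(1)])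
    also have "\<dots> \<le> C / s n"
      using C0 spos mono[OF that] by (intro divide_left_mono mult_pos_pos) auto
    finally show ?thesis
      unfolding norm_mult norm_of_real by (intro mult_mono P(4)) auto
  qed
  have main: "c / 4 * 2^n \<le> r (m (s n)) * norm (\<Sum>k. of_real (q k) * \<phi> (s k) (m (s n)))" for n
  proof -
    define t where "t = m (s n)"
    have sum: "summable (\<lambda>k. of_real (q k) * \<phi> (s k) t)"
      by (rule summable_geometric_bound[OF term_le[OF le0]])
    have split: "(\<Sum>k. of_real (q k) * \<phi> (s k) t) = (\<Sum>k. of_real (q (k + Suc n)) * \<phi> (s (k + Suc n)) t) + a n t"
      unfolding a by (rule suminf_split_initial_segment[OF sum])
    \<comment> \<open>The tail starts with weight \<open>(1/2)^(Suc n)\<close>, so its geometric sum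
      is \<open>(1/2)^n\<close> times the bound at the scale \<open>s (Suc n)\<close>.\<close>
    have "norm (\<Sum>k. of_real (q (k + Suc n)) * \<phi> (s (k + Suc n)) t) \<le> 2 * ((1/2)^(Suc n) * (C / s (Suc n)))"
    proof (rule norm_suminf_geometric_bound)
      show "norm (of_real (q (k + Suc n)) * \<phi> (s (k + Suc n)) t) \<le> (1/2)^k * ((1/2)^(Suc n) * (C / s (Suc n)))" for k
        using term_le[of "Suc n" "k + Suc n" t] by (simp add: power_add mult_ac)
    qed
    also have "\<dots> = (1/2)^n * (C / s (Suc n))" by simp
    also have "\<dots> \<le> 1 * (C / s (Suc n))"
      using C0 spos[of "Suc n"] by (intro mult_right_mono power_le_one) auto
    also have "\<dots> \<le> (1/2)^n * (c / s n) / 4" using R(2)[of n] by simp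
    finally have tail: "norm (\<Sum>k. of_real (q (k + Suc n)) * \<phi> (s (k + Suc n)) t) \<le> (1/2)^n * (c / s n) / 4" .
    have split_le: "norm (a n t) \<le> norm (\<Sum>k. of_real (q k) * \<phi> (s k) t)
        + norm (\<Sum>k. of_real (q (k + Suc n)) * \<phi> (s (k + Suc n)) t)"
      unfolding split by norm
    have low: "(1/2)^n * (c / s n) / 4 \<le> norm (\<Sum>k. of_real (q k) * \<phi> (s k) t)"
    proof -
      have "e / 4 \<le> u" if "x \<le> u + v" "v \<le> e / 4" "e / 2 \<le> x" for e u v x :: real
        using that by simp
      then show ?thesis
        using tail P(5)[of n] split_le unfolding t_def by blast
    qed
    have "c / 4 * 2^n = (4^n * s n) * ((1/2)^n * (c / s n) / 4)"
    proof -
      have "(4::real)^n * (1/2)^n = 2^n"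
        by (simp flip: power_mult_distrib)
      moreover have "(4^n * s n) * ((1/2)^n * (c / s n) / 4) = (4^n * (1/2)^n) * (c / 4) * (s n / s n)"
        by (simp only: times_divide_eq_right times_divide_eq_left mult_ac)
      ultimately show ?thesis using spos[of n] by simp
    qed
    also have "\<dots> \<le> r t * norm (\<Sum>k. of_real (q k) * \<phi> (s k) t)"
    proof (rule mult_mono)
      show "4^n * s n \<le> r t"
        using P(3)[of n] by (simp add: t_def)
      moreover have "0 \<le> 4^n * s n"
        using spos[of n] by simp
      ultimately show "0 \<le> r t" by (rule order_trans[rotated])
    qed (use low c spos[of n] in auto)
    finally show ?thesis by (simp add: t_def)
  qed
  show ?thesis by (rule that[of s q]) (use P main in auto)
qed

section \<open>Growth of \<open>M_K\<close> and its inverse\<close>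

text \<open>If \<open>Y s \<le> C * exp (\<alpha> * s)\<close>, the exponent is at most
  \<open>exp (\<alpha> * s) * (A * C - exp s * cos 1)\<close>. The extra \<open>1\<close> in
  \<open>\<alpha> + 1\<close> eventually pushes this below \<open>- 4 * s\<close>, and
  \<open>s^4 \<le> exp (4 * s)\<close>.\<close>

lemma eventually_double_exp_small:
  fixes Y :: "real \<Rightarrow> real"
  assumes Y: "Y \<in> O[at_top](\<lambda>s. exp (\<alpha> * s))" and \<alpha>: "\<alpha> > 0" and A: "A \<ge> 0"
  shows "\<forall>\<^sub>F s in at_top. s^4 * exp (A * Y s - cos 1 * exp ((\<alpha> + 1) * s)) \<le> 1"
proof -
  obtain C where C: "C > 0" "\<forall>\<^sub>F s in at_top. norm (Y s) \<le> C * norm (exp (\<alpha> * s))"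
    using Y by (elim landau_o.bigE) auto
  have cos1: "cos (1::real) > 0" using cos_ge_cos_one[of 1] by simp
  have "filterlim (\<lambda>s. exp s * cos 1 - A * C - 4 * s) at_top at_top"
    using cos1 by real_asymp
  then have "\<forall>\<^sub>F s in at_top. 0 \<le> exp s * cos 1 - A * C - 4 * s"
    unfolding filterlim_at_top by blast
  then show ?thesis
    using C(2) eventually_ge_at_top[of 0]
  proof eventually_elim
    case (elim s)
    have "A * Y s \<le> A * (C * exp (\<alpha> * s))"
      using elim(2) A by (intro mult_left_mono) auto
    then have "A * Y s - cos 1 * exp ((\<alpha> + 1) * s) \<le> exp (\<alpha> * s) * (A * C - exp s * cos 1)"
      by (simp add: algebra_simps exp_add)
    also have "\<dots> \<le> exp (\<alpha> * s) * (- (4 * s))"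
      using elim(1) by (intro mult_left_mono) auto
    also have "\<dots> \<le> 1 * (- (4 * s))"
      using elim(3) \<alpha> by (intro mult_right_mono_neg) auto
    finally have "s^4 * exp (A * Y s - cos 1 * exp ((\<alpha> + 1) * s)) \<le> exp s^4 * exp (- (4 * s))"
      using elim(3) order_trans[OF _ exp_ge_add_one_self[of s], of s] by (intro mult_mono power_mono) auto
    also have "exp s^4 * exp (- (4 * s)) = 1"
      by (simp add: exp_of_nat_mult[of 4, symmetric] flip: exp_add)
    finally show ?case .
  qed
qed

context
  fixes M K :: "real \<Rightarrow> real"
  assumes M: "\<And>s. s \<ge> 0 \<Longrightarrow> M s > 0" "mono_on {0..} M" "continuous_on {0..} M"
    and K: "\<And>s. s \<ge> 0 \<Longrightarrow> K s > 0" "mono_on {0..} K" "continuous_on {0..} K"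
begin

text \<open>Strictness comes from the summand \<open>ln (1 + s)\<close>, even where \<open>M\<close>
  and \<open>K\<close> are constant; the same summand makes \<open>M_K\<close> unbounded.\<close>

lemma strict_mono_on_M_K: "strict_mono_on {0..} (M_K M K)"
proof (rule strict_mono_onI)
  fix s t :: real assume st: "s \<in> {0..}" "t \<in> {0..}" "s < t"
  have "M s \<le> M t" "K s \<le> K t"
    using st M K by (auto intro: mono_onD)
  have "K s > 0" "K t > 0" "M s > 0" using M(1) K(1) st by auto
  then have "ln (1 + s) + ln (1 + K s) < ln (1 + t) + ln (1 + K t)"
    using st \<open>K s \<le> K t\<close> by (intro add_less_le_mono) auto
  then have "M s * (ln (1 + s) + ln (1 + K s)) < M s * (ln (1 + t) + ln (1 + K t))"
    using \<open>M s > 0\<close> by simp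
  also have "\<dots> \<le> M t * (ln (1 + t) + ln (1 + K t))"
    using \<open>M s \<le> M t\<close> st \<open>K t > 0\<close> by (intro mult_right_mono) auto
  finally show "M_K M K s < M_K M K t"
    by (simp add: M_K_def)
qed

lemma continuous_on_M_K: "continuous_on {0..} (M_K M K)"
proof -
  have "1 + K s \<noteq> 0" if "s \<ge> 0" for s using K(1)[OF that] by simp
  then show ?thesis
    unfolding M_K_def[abs_def] using M K by (intro continuous_intros) auto
qed

lemma filterlim_M_K: "filterlim (M_K M K) at_top at_top"
proof (rule filterlim_at_top_mono)
  show "filterlim (\<lambda>s. M 0 * ln (1 + s)) at_top at_top"
    using M(1)[of 0] by real_asymp
  show "\<forall>\<^sub>F s in at_top. M 0 * ln (1 + s) \<le> M_K M K s"
    using eventually_ge_at_top[of 0]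
  proof eventually_elim
    case (elim s)
    have "M 0 \<le> M s" "K s > 0" "M 0 > 0" using M K elim by (auto intro: mono_onD)
    then show ?case
      unfolding M_K_def using elim by (intro mult_mono) auto
  qed
qed

text \<open>The intermediate value theorem, with injectivity to identify the value of
  \<open>inv_into\<close>. It translates statements about large \<open>s\<close> into statements
  about large \<open>t = M_K s\<close>.\<close>

lemma eventually_M_K_inv:
  "\<forall>\<^sub>F t in at_top. M_K_inv M K t \<ge> N \<and> M_K M K (M_K_inv M K t) = t"
  using eventually_ge_at_top[of "M_K M K (max 0 N)"]
proof eventually_elim
  case (elim t)
  obtain b where b: "b \<ge> max 0 N" "M_K M K b \<ge> t"
    using filterlim_M_K[unfolded filterlim_at_top, rule_format, of t]
    by (metis (mono_tags, lifting) eventually_at_top_linorder linorder_linear)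
  have "\<exists>s\<ge>max 0 N. s \<le> b \<and> M_K M K s = t"
    using elim b continuous_on_subset[OF continuous_on_M_K, of "{max 0 N..b}"]
    by (intro IVT') auto
  then obtain s where s: "s \<ge> max 0 N" "M_K M K s = t" by blast
  moreover have "M_K_inv M K t = s"
    unfolding M_K_inv_def
    using s strict_mono_on_imp_inj_on[OF strict_mono_on_M_K] by (intro inv_into_f_eq) auto
  ultimately show ?case by simp
qed

end

section \<open>Contradiction from an admissible series of humps\<close>

theorem theorem2p3:
  fixes M K r :: "real \<Rightarrow> real" and \<alpha> :: real
  assumes "\<And>s. s \<ge> 0 \<Longrightarrow> M s > 0"
    and "\<And>s. s \<ge> 0 \<Longrightarrow> K s > 0"
    and "\<And>s. s \<ge> 0 \<Longrightarrow> r s > 0"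
    and "mono_on {0..} M"
    and "mono_on {0..} K"
    and "mono_on {0..} r"
    and "continuous_on {0..} M"
    and "continuous_on {0..} K"
    and "\<alpha> > 0"
    and "M_K M K \<in> O[at_top](\<lambda>s. exp (\<alpha> * s))"
    and "\<And>f :: real \<Rightarrow> complex. admissible M K f \<Longrightarrow>
           (\<lambda>t. norm (f t)) \<in> O[at_top](\<lambda>t. inverse (r t))"
  shows "r \<in> O[at_top](M_K_inv M K)"
proof (rule ccontr)
  assume contra: "r \<notin> O[at_top](M_K_inv M K)"
  note M = assms(1,4,7) and K = assms(2,5,8)
  \<comment> \<open>\<open>Omega M\<close> lies to the right of \<open>- 1 / M 0\<close>; the added
    \<open>1\<close> secures \<open>A \<ge> 1\<close>.\<close>
  define A where "A = 1 / M 0 + 1"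
  have A: "A \<ge> 1" "A \<ge> 1 / M 0" using M(1)[of 0] by (auto simp: A_def)
  define \<beta> where "\<beta> = \<alpha> + 1"
  have \<beta>: "\<beta> \<ge> 0" using assms(9) by (simp add: \<beta>_def)
  have "\<forall>\<^sub>F s in at_top. s^4 * exp (A * M_K M K s - cos 1 * exp (\<beta> * s)) \<le> 1"
    unfolding \<beta>_def using A by (intro eventually_double_exp_small assms(9,10)) auto
  then obtain s0 where s0: "s0 \<ge> 1" "\<And>s. s \<ge> s0 \<Longrightarrow> s^4 * exp (A * M_K M K s - cos 1 * exp (\<beta> * s)) \<le> 1"
    unfolding eventually_at_top_linorder by (metis max.bounded_iff max.cobounded2)
  define \<phi> where "\<phi> s t = (\<integral>w. test_kernel A \<beta> s (M_K M K s) (Complex 0 w) * cis (w * t) \<partial>lborel)" for s t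
  define B where "B = 1 + A * \<beta>"
  define c where "c = B * exp (-1) / (4 * A^2 + 4 * B^2)^2"
  have "B > 0" using A \<beta> by (simp add: B_def add_pos_nonneg)
  then have c: "c > 0"
    unfolding c_def by (intro divide_pos_pos mult_pos_pos zero_less_power add_nonneg_pos) auto
  have y0: "M_K M K s \<ge> 0" if "s \<ge> s0" for s
    using M(1)[of s] K(1)[of s] that s0 by (auto simp: M_K_def)
  have up: "norm (\<phi> s t) \<le> 4 * pi / s" if "s \<ge> s0" for s t
    unfolding \<phi>_def using that s0 y0 A
    by (intro norm_fourier_integral_test_kernel_le) auto
  have low: "c / s \<le> norm (\<phi> s (M_K M K s))" if "s \<ge> s0" for s
    unfolding \<phi>_def c_def B_def using that s0 y0 A \<beta>
    by (intro fourier_integral_test_kernel_ge integrable_test_kernel_line) auto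
  \<comment> \<open>Otherwise \<open>r (M_K s) \<le> D * s\<close> for all large \<open>s\<close>,
    and inserting \<open>s = M_K_inv t\<close> would give the bound on \<open>r\<close> that was
    assumed to fail.\<close>
  have bad: "\<exists>s\<ge>N. r (M_K M K s) > D * s" for D N
  proof (rule ccontr)
    assume "\<not> ?thesis"
    then have le: "r (M_K M K s) \<le> D * s" if "s \<ge> N" for s using that by force
    have inv: "\<forall>\<^sub>F t in at_top. M_K_inv M K t \<ge> N \<and> M_K M K (M_K_inv M K t) = t"
      by (rule eventually_M_K_inv) (use M K in auto)
    have "r \<in> O[at_top](M_K_inv M K)"
    proof (rule bigoI[where c = "\<bar>D\<bar>"])
      show "\<forall>\<^sub>F t in at_top. norm (r t) \<le> \<bar>D\<bar> * norm (M_K_inv M K t)"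
        using inv eventually_ge_at_top[of 0]
      proof eventually_elim
        case (elim t)
        have "norm (r t) = r (M_K M K (M_K_inv M K t))"
          using elim assms(3)[of t] by simp
        also have "\<dots> \<le> D * M_K_inv M K t"
          using elim by (intro le) auto
        also have "\<dots> \<le> \<bar>D\<bar> * norm (M_K_inv M K t)"
          by (metis abs_ge_self abs_mult real_norm_def)
        finally show ?case .
      qed
    qed
    with contra show False by simp
  qed
  \<comment> \<open>The hump at scale \<open>s\<close> has height of order \<open>1 / s\<close>,
    attained at \<open>t = M_K s\<close>.\<close>
  obtain s q :: "nat \<Rightarrow> real" where sq: "\<And>n. s n \<ge> s0" "\<And>n. s n \<ge> real n" "\<And>n. \<bar>q n\<bar> \<le> (1/2)^n"
    "\<And>n. c / 4 * 2^n \<le> r (M_K M K (s n)) * norm (\<Sum>k. of_real (q k) * \<phi> (s k) (M_K M K (s n)))"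
    by (rule gliding_hump[of s0 c \<phi> "4 * pi" "M_K M K" r]) (use s0 c up low bad in auto)
  define f where "f t = (\<Sum>n. of_real (q n) * \<phi> (s n) t)" for t
  have "admissible M K f"
    unfolding f_def \<phi>_def
    by (rule admissible_suminf_test_kernel[OF M K(1,2) A]) (use s0 sq order_trans in blast)+
  then have "(\<lambda>t. norm (f t)) \<in> O[at_top](\<lambda>t. inverse (r t))"
    by (rule assms(11))
  then obtain C where C: "C > 0" "\<forall>\<^sub>F t in at_top. norm (norm (f t)) \<le> C * norm (inverse (r t))"
    by (elim landau_o.bigE) auto
  have s_lim: "filterlim s at_top sequentially"
    using sq(2) by (intro filterlim_at_top_mono[OF filterlim_real_sequentially]) auto
  have lim: "filterlim (\<lambda>n. M_K M K (s n)) at_top sequentially"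
    by (intro filterlim_compose[OF filterlim_M_K]) (use M K s_lim in auto)
  \<comment> \<open>The decay hypothesis bounds \<open>r t * norm (f t)\<close> for large
    \<open>t\<close>, but along \<open>t = M_K (s n)\<close>, which tends to infinity since
    \<open>s n \<ge> n\<close>, the product is at least \<open>c / 4 * 2^n\<close>.\<close>
  have "\<forall>\<^sub>F t in at_top. r t * norm (f t) \<le> C"
    using C(2) eventually_ge_at_top[of 0]
  proof eventually_elim
    case (elim t)
    have "r t * norm (f t) \<le> r t * (C * norm (inverse (r t)))"
      using elim assms(3)[of t] by (intro mult_left_mono) auto
    also have "\<dots> = C" using assms(3)[of t] elim by simp
    finally show ?case .
  qed
  then have "\<forall>\<^sub>F n in sequentially. r (M_K M K (s n)) * norm (f (M_K M K (s n))) \<le> C"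
    using lim unfolding filterlim_iff by blast
  moreover have "filterlim (\<lambda>n. c / 4 * 2^n) at_top sequentially"
    using c by real_asymp
  then have "\<forall>\<^sub>F n in sequentially. C < c / 4 * 2^n"
    by (auto simp: filterlim_at_top_dense)
  ultimately have "\<forall>\<^sub>F n in sequentially. False"
  proof eventually_elim
    case (elim n)
    then show False using sq(4)[of n] by (simp add: f_def)
  qed
  then show False by simp
qed

end
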